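(* Let $D>1$ be a square-free integer, let $\mathcal{O}_D$ be the ring of integers of $\mathbb{Q}(\sqrt{D})\subset\mathbb{R}$, and let $\varepsilon>1$ be the fundamental unit of $\mathcal{O}_D$, assumed to satisfy $N(\varepsilon)=-1$. Let $q=D$ if $D\equiv 1 \bmod 4$ and $q=4D$ otherwise, and set $F_D(n)=\operatorname{Tr}_{\mathbb{Q}(\sqrt D)/\mathbb{Q}}(\varepsilon^n/\sqrt{q})$. Define \[ Z_D^{\textup{odd}}(s)=\sum_{n\ge1}\frac{1}{F_D(2n-1)^s},\qquad Z_D^{\textup{even}}(s)=\sum_{n\ge1}\frac{1}{F_D(2n)^s} \] (convergent for $\Re s>0$). Then these functions admit meromorphic continuation to $s\in\mathbb{C}$, and \[ Z_D^{\textup{odd}}(s)=\frac{q^{s/2}}{8\Gamma(s)\log\varepsilon}\sum_{m\in\mathbb{Z}}(-1)^m\Gamma\Big(\frac{s}{2}+\frac{\pi i m}{2\log\varepsilon}\Big)\Gamma\Big(\frac{s}{2}-\frac{\pi i m}{2\log\varepsilon}\Big) \] for all $s\in\mathbb{C}$, and \[ Z_D^{\textup{even}}(s)=\frac{q^{s/2}\Gamma(1-s)}{4\log\varepsilon}\sum_{m\in\mathbb{Z}}\frac{\Gamma\big(\frac{s}{2}-\frac{\pi i m}{2\log\varepsilon}\big)}{\Gamma\big(1-\frac{s}{2}-\frac{\pi i m}{2\log\varepsilon}\big)} \] for $\Re s<0$.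
   Context: $\operatorname{Tr}$ denotes the field trace from $\mathbb{Q}(\sqrt D)$ to $\mathbb{Q}$; $N$ denotes the field norm. The fundamental unit $\varepsilon>1$ generates the unit group of $\mathcal{O}_D$ modulo $\pm1$. For $D=5$, $F_5(n)$ is the usual Fibonacci sequence. *)

theory Defs
  imports
    "HOL-Complex_Analysis.Complex_Analysis"
    "HOL-Computational_Algebra.Squarefree"
    "HOL-Library.FuncSet"
begin

definition quad_field :: "int \<Rightarrow> real set" where
  "quad_field D = {of_rat a + of_rat b * sqrt (of_int D) | a b. True}"

text \<open>
  Field automorphisms of a subfield of the reals; they automatically fix the rationals. The
  condition of being extensional makes an automorphism determined by its values on \<open>K\<close>.
\<close>
definition field_auts :: "real set \<Rightarrow> (real \<Rightarrow> real) set" where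
  "field_auts K = {\<sigma> \<in> K \<rightarrow>\<^sub>E K. bij_betw \<sigma> K K \<and> \<sigma> 1 = 1 \<and>
     (\<forall>x\<in>K. \<forall>y\<in>K. \<sigma> (x + y) = \<sigma> x + \<sigma> y \<and> \<sigma> (x * y) = \<sigma> x * \<sigma> y)}"

text \<open>
  Trace and norm down to the rationals as sum and product over the Galois group: this is the field
  trace and norm when \<open>K\<close> is a finite Galois extension of the rationals, as quadratic fields are.
\<close>
definition field_trace :: "real set \<Rightarrow> real \<Rightarrow> real" where
  "field_trace K x = (\<Sum>\<sigma>\<in>field_auts K. \<sigma> x)"

definition field_norm :: "real set \<Rightarrow> real \<Rightarrow> real" where
  "field_norm K x = (\<Prod>\<sigma>\<in>field_auts K. \<sigma> x)"

definition ring_of_integers :: "real set \<Rightarrow> real set" where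
  "ring_of_integers K = {x \<in> K. algebraic_int x}"

definition unit_group :: "real set \<Rightarrow> real set" where
  "unit_group R = {u \<in> R. \<exists>v\<in>R. u * v = 1}"

definition fundamental_unit :: "int \<Rightarrow> real \<Rightarrow> bool" where
  "fundamental_unit D \<epsilon> \<longleftrightarrow>
     (let U = unit_group (ring_of_integers (quad_field D)) in
        \<epsilon> \<in> U \<and> \<epsilon> > 1 \<and> (\<forall>u\<in>U. \<exists>n::int. u = \<epsilon> powi n \<or> u = - (\<epsilon> powi n)))"

definition quad_disc :: "int \<Rightarrow> int" where
  "quad_disc D = (if D mod 4 = 1 then D else 4 * D)"

definition gen_fib :: "int \<Rightarrow> real \<Rightarrow> nat \<Rightarrow> real" where
  "gen_fib D \<epsilon> n = field_trace (quad_field D) (\<epsilon> ^ n / sqrt (of_int (quad_disc D)))"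

lemma sqrt_squarefree_irrational:
  assumes "D > 1" "squarefree (D :: int)"
  shows "sqrt (of_int D) \<notin> \<rat>"
proof
  assume "sqrt (of_int D) \<in> \<rat>"
  moreover have "algebraic_int (sqrt (of_int D))"
    by (intro algebraic_int_sqrt) auto
  ultimately obtain k :: int where k: "sqrt (of_int D) = of_int k"
    using rational_algebraic_int_is_int Ints_cases by metis
  have "of_int D = (sqrt (of_int D))\<^sup>2"
    using assms by simp
  hence "(of_int D :: real) = of_int (k\<^sup>2)"
    unfolding k by simp
  hence D: "D = k\<^sup>2"
    using of_int_eq_iff by blast
  hence "k dvd 1"
    using squarefreeD[OF assms(2), of k] by simp
  hence "k\<^sup>2 = 1"
    by (simp add: power2_eq_1_iff abs_if split: if_splits)
  with D assms(1) show False by simp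
qed

lemma quad_field_coords_unique:
  assumes "D > 1" "squarefree (D :: int)"
    and "of_rat a + of_rat b * sqrt (of_int D) = of_rat c + of_rat d * sqrt (of_int D)"
  shows "a = c \<and> b = d"
proof -
  have "b = d"
  proof (rule ccontr)
    assume "b \<noteq> d"
    hence "sqrt (of_int D) = (of_rat ((c - a) / (b - d)) :: real)"
      using assms(3) by (simp add: of_rat_divide of_rat_diff field_simps)
    thus False
      using sqrt_squarefree_irrational[OF assms(1,2)] by simp
  qed
  thus ?thesis using assms(3) by simp
qed


lemma field_auts_of_rat:
  assumes \<sigma>: "\<sigma> \<in> field_auts K" and K: "\<rat> \<subseteq> K"
  shows "\<sigma> (of_rat r) = of_rat r"
proof -
  have add: "\<sigma> (x + y) = \<sigma> x + \<sigma> y" and mult: "\<sigma> (x * y) = \<sigma> x * \<sigma> y"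
    if "x \<in> K" "y \<in> K" for x y
    using \<sigma> that by (auto simp: field_auts_def)
  have one: "\<sigma> 1 = 1" using \<sigma> by (simp add: field_auts_def)
  have ratK: "x \<in> K" if "x \<in> \<rat>" for x using K that by blast
  have zero: "\<sigma> 0 = 0" using add[of 0 0] ratK[of 0] by simp
  have nat: "\<sigma> (of_nat n) = of_nat n" for n
    by (induction n) (simp_all add: zero one add ratK)
  have neg: "\<sigma> (- of_nat n) = - of_nat n" for n
    using add[of "of_nat n" "- of_nat n"] ratK[of "of_nat n"] ratK[of "- of_nat n"]
    by (simp add: zero nat)
  have int: "\<sigma> (of_int k) = of_int k" for k
    by (cases k rule: int_cases2) (simp_all add: nat neg)
  obtain a b where ab: "r = Rat.Fract a b" "b > 0" by (cases r) auto
  hence r: "of_rat r = (of_int a / of_int b :: real)" by (simp add: of_rat_rat)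
  have "\<sigma> (of_rat r) * \<sigma> (of_int b) = \<sigma> (of_rat r * of_int b)"
    by (subst mult) (auto intro: ratK)
  also have "of_rat r * of_int b = (of_int a :: real)" using r ab by simp
  finally have "\<sigma> (of_rat r) = of_int a / of_int b"
    using ab(2) by (simp add: int field_simps)
  thus ?thesis by (simp only: r)
qed

lemma Rats_subset_quad_field: "\<rat> \<subseteq> quad_field D"
proof
  fix x :: real assume "x \<in> \<rat>"
  then obtain r where "x = of_rat r" by (auto elim: Rats_cases)
  hence "x = of_rat r + of_rat 0 * sqrt (of_int D)" by simp
  thus "x \<in> quad_field D" unfolding quad_field_def by blast
qed

lemma field_auts_quad_field:
  assumes D: "D > 1" "squarefree (D :: int)"
  obtains conj where
    "field_auts (quad_field D) = {restrict (\<lambda>x. x) (quad_field D), conj}"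
    "restrict (\<lambda>x. x) (quad_field D) \<noteq> conj"
    "\<And>a b. conj (of_rat a + of_rat b * sqrt (of_int D)) = of_rat a - of_rat b * sqrt (of_int D)"
proof -
  define K where "K = quad_field D"
  define s where "s = sqrt (of_int D)"
  define e where "e a b = of_rat a + of_rat b * s" for a b
  have s2: "s * s = of_rat (of_int D)" using D by (simp add: s_def)
  have K: "K = {e a b | a b. True}" by (auto simp: K_def quad_field_def e_def s_def)
  have eK: "e a b \<in> K" for a b by (auto simp: K)
  have KE: "\<exists>a b. x = e a b" if "x \<in> K" for x using that by (auto simp: K)
  have inj: "e a b = e c d \<longleftrightarrow> a = c \<and> b = d" for a b c d
    using quad_field_coords_unique[OF D, of a b c d] by (auto simp: e_def s_def)
  have eadd: "e a b + e c d = e (a + c) (b + d)" for a b c d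
    by (simp add: e_def of_rat_add algebra_simps)
  have emult: "e a b * e c d = e (a * c + b * d * of_int D) (a * d + b * c)" for a b c d
  proof -
    have "e a b * e c d = of_rat a * of_rat c + of_rat b * of_rat d * (s * s) +
            (of_rat a * of_rat d + of_rat b * of_rat c) * s"
      by (simp add: e_def algebra_simps)
    thus ?thesis unfolding s2 by (simp add: e_def of_rat_add of_rat_mult)
  qed
  define conj where
    "conj = restrict (\<lambda>x. e (THE a. \<exists>b. x = e a b) (- (THE b. \<exists>a. x = e a b))) K"
  have conj: "conj (e a b) = e a (- b)" for a b
    using eK by (simp add: conj_def inj)
  have one: "1 = e 1 0" by (simp add: e_def)
  have "bij_betw conj K K"
    by (rule bij_betw_byWitness[where f' = conj]) (auto dest!: KE simp: conj eK)
  moreover have "conj \<in> K \<rightarrow>\<^sub>E K"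
    by (auto dest!: KE simp: conj eK conj_def)
  moreover have "conj (x + y) = conj x + conj y \<and> conj (x * y) = conj x * conj y"
    if "x \<in> K" "y \<in> K" for x y
    using KE[OF that(1)] KE[OF that(2)] by (auto simp: eadd emult conj inj algebra_simps)
  moreover have "conj 1 = 1" by (simp add: one conj)
  ultimately have conj_in: "conj \<in> field_auts K" by (simp add: field_auts_def)
  have "x + y \<in> K" "x * y \<in> K" if "x \<in> K" "y \<in> K" for x y
    using KE[OF that(1)] KE[OF that(2)] by (auto simp: eadd emult eK)
  hence id_in: "restrict (\<lambda>x. x) K \<in> field_auts K"
    using eK[of 1 0] by (auto simp: field_auts_def one[symmetric] bij_betw_def inj_on_def)
  have "\<sigma> = restrict (\<lambda>x. x) K \<or> \<sigma> = conj" if \<sigma>: "\<sigma> \<in> field_auts K" for \<sigma>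
  proof -
    have rat: "\<sigma> (of_rat r) = of_rat r" for r
      using field_auts_of_rat[OF \<sigma>] Rats_subset_quad_field by (simp add: K_def)
    have add: "\<sigma> (x + y) = \<sigma> x + \<sigma> y" and mult: "\<sigma> (x * y) = \<sigma> x * \<sigma> y"
      if "x \<in> K" "y \<in> K" for x y
      using \<sigma> that by (auto simp: field_auts_def)
    have ratK: "of_rat r \<in> K" for r using eK[of r 0] by (simp add: e_def)
    have sK: "s \<in> K" using eK[of 0 1] by (simp add: e_def)
    have bsK: "of_rat b * s \<in> K" for b using eK[of 0 b] by (simp add: e_def)
    have \<sigma>e: "\<sigma> (e a b) = of_rat a + of_rat b * \<sigma> s" for a b
      unfolding e_def by (simp only: add mult rat ratK sK bsK)
    have "\<sigma> s * \<sigma> s = s * s"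
      using mult[OF sK sK] rat[of "of_int D"] s2 by simp
    hence "\<sigma> s = s \<or> \<sigma> s = - s" by (simp add: square_eq_iff)
    thus ?thesis
    proof
      assume "\<sigma> s = s"
      hence "\<sigma> x = restrict (\<lambda>x. x) K x" for x
        using \<sigma> KE[of x] \<sigma>e by (cases "x \<in> K") (auto simp: field_auts_def e_def)
      thus ?thesis by blast
    next
      assume "\<sigma> s = - s"
      hence "\<sigma> (e a b) = conj (e a b)" for a b
        by (simp add: conj \<sigma>e) (simp add: e_def of_rat_minus)
      hence "\<sigma> x = conj x" for x
        using \<sigma> KE[of x] by (cases "x \<in> K") (auto simp: field_auts_def conj_def)
      thus ?thesis by blast
    qed
  qed
  with conj_in id_in have "field_auts K = {restrict (\<lambda>x. x) K, conj}" by blast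
  moreover have "restrict (\<lambda>x. x) K (e 0 1) \<noteq> conj (e 0 1)"
    unfolding conj by (simp add: eK inj)
  hence "restrict (\<lambda>x. x) K \<noteq> conj" by metis
  moreover have "conj (of_rat a + of_rat b * s) = of_rat a - of_rat b * s" for a b
    using conj[of a b] by (simp add: e_def of_rat_minus)
  ultimately show ?thesis using that[of conj] by (simp add: K_def s_def)
qed

lemma
  assumes D: "D > 1" "squarefree (D :: int)"
  shows field_trace_quad_field:
      "field_trace (quad_field D) (of_rat a + of_rat b * sqrt (of_int D)) = 2 * of_rat a"
    and field_norm_quad_field:
      "field_norm (quad_field D) (of_rat a + of_rat b * sqrt (of_int D)) =
         (of_rat a)\<^sup>2 - of_int D * (of_rat b)\<^sup>2"
proof -
  obtain conj where conj:
    "field_auts (quad_field D) = {restrict (\<lambda>x. x) (quad_field D), conj}"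
    "restrict (\<lambda>x. x) (quad_field D) \<noteq> conj"
    "\<And>a b. conj (of_rat a + of_rat b * sqrt (of_int D)) = of_rat a - of_rat b * sqrt (of_int D)"
    using field_auts_quad_field[OF D] by blast
  have mem: "of_rat a + of_rat b * sqrt (of_int D) \<in> quad_field D"
    unfolding quad_field_def by blast
  show "field_trace (quad_field D) (of_rat a + of_rat b * sqrt (of_int D)) = 2 * of_rat a"
    using conj(2) mem by (simp add: field_trace_def conj(1,3))
  have "sqrt (of_int D) * sqrt (of_int D) = (of_int D :: real)" using D by simp
  thus "field_norm (quad_field D) (of_rat a + of_rat b * sqrt (of_int D)) =
         (of_rat a)\<^sup>2 - of_int D * (of_rat b)\<^sup>2"
    using conj(2) mem by (simp add: field_norm_def conj(1,3) power2_eq_square algebra_simps)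
qed

end

theory Submission
  imports Defs "HOL-Real_Asymp.Real_Asymp"
begin

text \<open>
  Since the conjugate of \<open>\<epsilon>\<close> is \<open>-1 / \<epsilon>\<close>, the numbers \<open>sqrt q * F n\<close> are \<open>2 cosh (n ln \<epsilon>)\<close> for odd and
  \<open>2 sinh (n ln \<epsilon>)\<close> for even \<open>n\<close>. Expanding their powers by the binomial series and summing the
  geometric series over \<open>n\<close> turns both functions into series over \<open>k\<close> with, up to sign, summands
  \<open>(s)\<^sub>k / k!\<close> times \<open>1 / (2 sinh (w ln \<epsilon>))\<close> or \<open>1 / (exp (2 w ln \<epsilon>) - 1)\<close>, where \<open>w = s + 2 k\<close>.
  These converge locally uniformly away from their poles and give the meromorphic continuation.
  For \<open>Re s < 0\<close>, replacing the hyperbolic factors by their partial fractions in \<open>w\<close> gives double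
  series which, suitably regularised, converge absolutely; carrying out the sum over \<open>k\<close> first
  produces the Gamma factors. This is the even formula. The odd formula is obtained in this way for
  \<open>-1 < Re s < 0\<close> and extends to all \<open>s\<close> by the identity theorem.
\<close>

section \<open>Partial fractions and Gamma quotients\<close>

text \<open>Both sums over \<open>k\<close> are Beta integrals in disguise. Expanding (1 - x) powr
  (-s) inside the integral of x powr (a - 1) * (1 - x) powr (-s) over [0, 1] gives Gamma (1 - s) *
  Gamma a / Gamma (a + 1 - s). In the odd case the integral of x powr (a - 1) * (1 + x) powr (-s)
  over [0, infinity) is cut at 1 and folded by x -> 1 / x; hence the paired poles -k and s + k. At
  the points a = s / 2 - 2 pi i m / h in question Re a < 0 and these integrals diverge, so the
  expansions are derived algebraically. The obstacle is absolute convergence of the double series.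
  Its coefficients have size k powr (Re s - 1), and the partial fractions in \<open>m\<close>
  converge only conditionally unless two of them are combined; the decay must then be shared between
  \<open>k\<close> and \<open>m\<close> so that both indices get an exponent below -1. The
  exceptional points agree on both sides: the \<open>k\<close>-th summand has a vanishing
  denominator exactly where some s / 2 - 2 pi i m / h equals -k, a pole of a Gamma factor.\<close>

lemma partial_fractions:
  fixes p :: "'a::field poly"
  assumes X: "finite X" and deg: "degree p < card X" and a: "a \<notin> X"
  shows "poly p a / (\<Prod>x\<in>X. a - x) = (\<Sum>x\<in>X. poly p x / (\<Prod>y\<in>X-{x}. x - y) / (a - x))"
proof -
  define c where "c x = poly p x / (\<Prod>y\<in>X-{x}. x - y)" for x
  define q where "q = (\<Sum>x\<in>X. smult (c x) (\<Prod>y\<in>X-{x}. [:-y, 1:]))"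
  have poly_q: "poly q z = (\<Sum>x\<in>X. c x * (\<Prod>y\<in>X-{x}. z - y))" for z
    by (simp add: q_def poly_sum poly_prod)
  \<comment> \<open>Lagrange interpolation: both polynomials have degree below \<open>card X\<close>
    and agree on \<open>X\<close>.\<close>
  have "p = q"
  proof (rule poly_eqI_degree)
    fix z assume z: "z \<in> X"
    have "(\<Sum>x\<in>X. c x * (\<Prod>y\<in>X-{x}. z - y)) = (\<Sum>x\<in>{z}. c x * (\<Prod>y\<in>X-{x}. z - y))"
      using X z by (intro sum.mono_neutral_right) (auto simp: prod_zero_iff)
    also have "\<dots> = poly p z"
      using X by (auto simp: c_def)
    finally show "poly p z = poly q z"
      by (simp add: poly_q)
  next
    show "degree p < card X" by (rule deg)
    have "degree q \<le> card X - 1"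
      unfolding q_def
    proof (intro degree_sum_le X)
      fix x assume x: "x \<in> X"
      have "degree (smult (c x) (\<Prod>y\<in>X-{x}. [:-y, 1:])) \<le> degree (\<Prod>y\<in>X-{x}. [:-y, 1:])"
        by (rule degree_smult_le)
      also have "\<dots> \<le> (\<Sum>y\<in>X-{x}. degree [:-y, 1:])"
        by (rule order.trans[OF degree_prod_sum_le]) (use X in auto)
      finally show "degree (smult (c x) (\<Prod>y\<in>X-{x}. [:-y, 1:])) \<le> card X - 1"
        using X x by simp
    qed
    thus "degree q < card X" using deg by linarith
  qed
  hence "poly p a / (\<Prod>x\<in>X. a - x) = (\<Sum>x\<in>X. c x * (\<Prod>y\<in>X-{x}. a - y) / (\<Prod>x\<in>X. a - x))"
    by (simp add: poly_q sum_divide_distrib)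
  also have "\<dots> = (\<Sum>x\<in>X. c x / (a - x))"
  proof (intro sum.cong refl)
    fix x assume x: "x \<in> X"
    have "(\<Prod>x\<in>X. a - x) = (a - x) * (\<Prod>y\<in>X-{x}. a - y)"
      using X x by (simp add: prod.remove)
    moreover have "(\<Prod>y\<in>X-{x}. a - y) \<noteq> 0" "a - x \<noteq> 0"
      using X a x by (auto simp: prod_zero_iff)
    ultimately show "c x * (\<Prod>y\<in>X-{x}. a - y) / (\<Prod>x\<in>X. a - x) = c x / (a - x)"
      by simp
  qed
  finally show ?thesis by (simp add: c_def)
qed

lemma prod_diff_of_nat:
  assumes "k \<le> n"
  shows "(\<Prod>j\<in>{..n}-{k}. of_nat j - of_nat k) = ((-1)^k * fact k * fact (n - k) :: 'a::field_char_0)"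
proof -
  have "{..n}-{k} = {..<k} \<union> {k<..n}" "{..<k} \<inter> {k<..n} = {}" using assms by auto
  hence "(\<Prod>j\<in>{..n}-{k}. of_nat j - of_nat k :: 'a) =
      (\<Prod>j<k. of_nat j - of_nat k) * (\<Prod>j\<in>{k<..n}. of_nat j - of_nat k)"
    by (simp add: prod.union_disjoint)
  also have "(\<Prod>j<k. of_nat j - of_nat k :: 'a) = (\<Prod>i\<in>{1..k}. - of_nat i)"
    by (intro prod.reindex_bij_witness[of _ "\<lambda>i. k - i" "\<lambda>j. k - j"]) (auto simp: of_nat_diff)
  also have "\<dots> = (-1)^k * fact k"
    by (simp add: fact_prod prod.distrib[symmetric] prod_uminus)
  also have "(\<Prod>j\<in>{k<..n}. of_nat j - of_nat k :: 'a) = (\<Prod>i\<in>{1..n-k}. of_nat i)"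
    using assms by (intro prod.reindex_bij_witness[of _ "\<lambda>i. k + i" "\<lambda>j. j - k"]) (auto simp: of_nat_diff)
  also have "\<dots> = fact (n - k)"
    by (simp add: fact_prod)
  finally show ?thesis by simp
qed

lemma not_nonpos_Ints_add_of_nat:
  "a \<notin> \<int>\<^sub>\<le>\<^sub>0 \<Longrightarrow> a + of_nat k \<noteq> (0::'a::field_char_0)"
  by (metis add_eq_0_iff2 minus_of_nat_in_nonpos_Ints)

lemma inj_on_uminus_of_nat: "inj_on (\<lambda>k. - of_nat k :: 'a::field_char_0) A"
  by (auto simp: inj_on_def)

text \<open>Partial fractions in the variable \<open>a\<close>: the denominator has the n + 1 simple
  zeros 0, -1, ..., -n, and the numerator has degree only \<open>n\<close>.\<close>

lemma pochhammer_quotient_partial_fractions: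
  fixes a b :: "'a::field_char_0"
  assumes a: "a \<notin> \<int>\<^sub>\<le>\<^sub>0"
  shows "pochhammer (a + b) n / pochhammer a (Suc n) =
    (\<Sum>k\<le>n. pochhammer (b - of_nat k) n / ((-1)^k * fact k * fact (n - k)) / (a + of_nat k))"
proof -
  define f where "f = (\<lambda>k. - of_nat k :: 'a)"
  define X where "X = f ` {..n}"
  define p where "p = (\<Prod>j<n. [:b + of_nat j, 1:])"
  have inj: "inj_on f A" for A unfolding f_def by (rule inj_on_uminus_of_nat)
  have poly_p: "poly p z = pochhammer (z + b) n" for z
    by (simp add: p_def poly_prod pochhammer_prod algebra_simps atLeast0LessThan)
  have "a \<notin> X"
    using not_nonpos_Ints_add_of_nat[OF a] by (auto simp: X_def f_def add_eq_0_iff2)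
  moreover have "degree p \<le> (\<Sum>j<n. 1)"
    unfolding p_def by (rule order.trans[OF degree_prod_sum_le]) auto
  hence "degree p < card X" by (simp add: X_def card_image inj)
  ultimately have "poly p a / (\<Prod>x\<in>X. a - x) = (\<Sum>x\<in>X. poly p x / (\<Prod>y\<in>X-{x}. x - y) / (a - x))"
    by (intro partial_fractions) (auto simp: X_def)
  also have "(\<Prod>x\<in>X. a - x) = pochhammer a (Suc n)"
    by (simp add: X_def prod.reindex[OF inj] pochhammer_prod atLeast0_lessThan_Suc_eq_insert_0 atLeast0AtMost atLeastLessThanSuc_atLeastAtMost del: pochhammer_Suc)
       (simp add: f_def)
  also have "(\<Sum>x\<in>X. poly p x / (\<Prod>y\<in>X-{x}. x - y) / (a - x)) =
     (\<Sum>k\<le>n. poly p (f k) / (\<Prod>y\<in>X-{f k}. f k - y) / (a - f k))"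
    by (simp add: X_def sum.reindex[OF inj])
  also have "\<dots> = (\<Sum>k\<le>n. pochhammer (b - of_nat k) n / ((-1)^k * fact k * fact (n - k)) / (a + of_nat k))"
  proof (intro sum.cong refl)
    fix k assume k: "k \<in> {..n}"
    have "X - {f k} = f ` ({..n} - {k})"
      using inj[of UNIV] k by (auto simp: X_def inj_on_def)
    hence "(\<Prod>y\<in>X-{f k}. f k - y) = (\<Prod>j\<in>{..n}-{k}. f k - f j)"
      by (simp add: prod.reindex[OF inj])
    hence "(\<Prod>y\<in>X-{f k}. f k - y) = (\<Prod>j\<in>{..n}-{k}. of_nat j - of_nat k)"
      by (simp add: f_def)
    thus "poly p (f k) / (\<Prod>y\<in>X-{f k}. f k - y) / (a - f k) =
        pochhammer (b - of_nat k) n / ((-1)^k * fact k * fact (n - k)) / (a + of_nat k)"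
      using k prod_diff_of_nat[of k n, where 'a='a] by (simp add: poly_p f_def)
  qed
  finally show ?thesis by (simp add: poly_p)
qed

text \<open>As a function of \<open>a\<close> the left side has simple poles at -k and at s + k,
  which are distinct because \<open>s\<close> is not a nonpositive integer. The symmetry a -> s - a
  exchanges the two families, so that each pair shares one coefficient.\<close>

lemma inverse_pochhammer_mult_partial_fractions:
  fixes a s :: "'a::field_char_0"
  assumes a: "a \<notin> \<int>\<^sub>\<le>\<^sub>0" and b: "s - a \<notin> \<int>\<^sub>\<le>\<^sub>0" and s: "s \<notin> \<int>\<^sub>\<le>\<^sub>0"
  shows "1 / (pochhammer a (Suc n) * pochhammer (s - a) (Suc n)) =
    (\<Sum>k\<le>n. (-1)^k / (fact k * fact (n - k) * pochhammer (s + of_nat k) (Suc n)) *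
      (1 / (a + of_nat k) + 1 / (s - a + of_nat k)))"
proof -
  define f where "f = (\<lambda>k. - of_nat k :: 'a)"
  define g where "g = (\<lambda>k. s + of_nat k :: 'a)"
  define X where "X = f ` {..n}"
  define Y where "Y = g ` {..n}"
  have inj: "inj_on f A" "inj_on g A" for A 
    unfolding f_def g_def by (auto simp: inj_on_def)
  have fg: "f i \<noteq> g j" for i j
    using not_nonpos_Ints_add_of_nat[OF s, of "i + j"] 
    by (auto simp: f_def g_def add_eq_0_iff2 algebra_simps)
  have disj: "X \<inter> Y = {}" using fg by (auto simp: X_def Y_def)
  have fin: "finite X" "finite Y" by (auto simp: X_def Y_def)
  have aX: "a \<notin> X"
    using not_nonpos_Ints_add_of_nat[OF a] by (auto simp: X_def f_def add_eq_0_iff2)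
  have aY: "a \<notin> Y"
  proof
    assume "a \<in> Y"
    then obtain k where "a = s + of_nat k" by (auto simp: Y_def g_def)
    thus False using not_nonpos_Ints_add_of_nat[OF b, of k] by simp
  qed
  have P: "(\<Prod>j\<le>n. z + of_nat j) = pochhammer z (Suc n)" for z :: 'a
    by (simp add: pochhammer_prod lessThan_Suc_atMost[symmetric] atLeast0LessThan)
  have M: "(\<Prod>j\<le>n. - z - of_nat j) = (-1)^Suc n * pochhammer z (Suc n)" for z :: 'a
  proof -
    have "(\<Prod>j\<le>n. - z - of_nat j) = (\<Prod>j\<le>n. - (z + of_nat j))" by simp
    also have "\<dots> = (-1)^Suc n * pochhammer z (Suc n)"
      by (subst prod_uminus) (simp add: P)
    finally show ?thesis .
  qed
  have "1 / (\<Prod>x\<in>X \<union> Y. a - x) = (\<Sum>x\<in>X \<union> Y. 1 / (\<Prod>y\<in>X\<union>Y-{x}. x - y) / (a - x))"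
    using partial_fractions[of "X \<union> Y" 1 a] aX aY fin disj
    by (simp add: card_Un_disjoint X_def Y_def card_image inj)
  also have "(\<Prod>x\<in>X \<union> Y. a - x) = pochhammer a (Suc n) * ((-1)^Suc n * pochhammer (s - a) (Suc n))"
    using disj fin P[of a] M[of "s - a"]
    by (simp add: prod.union_disjoint X_def Y_def prod.reindex[OF inj(1)] prod.reindex[OF inj(2)])
       (simp add: f_def g_def algebra_simps)
  also have "(\<Sum>x\<in>X \<union> Y. 1 / (\<Prod>y\<in>X\<union>Y-{x}. x - y) / (a - x)) =
     (\<Sum>k\<le>n. 1 / (\<Prod>y\<in>X\<union>Y-{f k}. f k - y) / (a - f k)) + (\<Sum>k\<le>n. 1 / (\<Prod>y\<in>X\<union>Y-{g k}. g k - y) / (a - g k))"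
    using disj fin by (simp add: sum.union_disjoint) (simp add: X_def Y_def sum.reindex[OF inj(1)] sum.reindex[OF inj(2)])
  also have "(\<Sum>k\<le>n. 1 / (\<Prod>y\<in>X\<union>Y-{f k}. f k - y) / (a - f k)) =
     (\<Sum>k\<le>n. (-1)^Suc n * ((-1)^k / (fact k * fact (n - k) * pochhammer (s + of_nat k) (Suc n)) / (a + of_nat k)))"
  proof (intro sum.cong refl)
    fix k assume k: "k \<in> {..n}"
    have "X \<union> Y - {f k} = f ` ({..n} - {k}) \<union> Y"
      using inj(1)[of UNIV] k fg by (auto simp: X_def Y_def inj_on_def)
    moreover have "f ` ({..n} - {k}) \<inter> Y = {}" using disj by (auto simp: X_def)
    ultimately have "(\<Prod>y\<in>X\<union>Y-{f k}. f k - y) = (\<Prod>j\<in>{..n}-{k}. f k - f j) * (\<Prod>j\<le>n. f k - g j)"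
      using fin by (simp add: prod.union_disjoint prod.reindex[OF inj(1)]) (simp add: Y_def prod.reindex[OF inj(2)])
    also have "(\<Prod>j\<in>{..n}-{k}. f k - f j) = (-1)^k * fact k * fact (n - k)"
      using k prod_diff_of_nat[of k n, where 'a='a] by (simp add: f_def)
    also have "(\<Prod>j\<le>n. f k - g j) = (-1)^Suc n * pochhammer (s + of_nat k) (Suc n)"
      unfolding M[symmetric] f_def g_def by (intro prod.cong) (simp_all add: algebra_simps)
    finally show "1 / (\<Prod>y\<in>X\<union>Y-{f k}. f k - y) / (a - f k) = 
       (-1)^Suc n * ((-1)^k / (fact k * fact (n - k) * pochhammer (s + of_nat k) (Suc n)) / (a + of_nat k))"
      by (auto simp: f_def uminus_power_if)
  qed
  also have "(\<Sum>k\<le>n. 1 / (\<Prod>y\<in>X\<union>Y-{g k}. g k - y) / (a - g k)) =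
     (\<Sum>k\<le>n. (-1)^Suc n * ((-1)^k / (fact k * fact (n - k) * pochhammer (s + of_nat k) (Suc n)) / (s - a + of_nat k)))"
  proof (intro sum.cong refl)
    fix k assume k: "k \<in> {..n}"
    have "X \<union> Y - {g k} = X \<union> g ` ({..n} - {k})"
      using inj(2)[of UNIV] k fg by (auto simp: X_def Y_def inj_on_def) (metis fg)
    moreover have "X \<inter> g ` ({..n} - {k}) = {}" using disj by (auto simp: Y_def)
    ultimately have "(\<Prod>y\<in>X\<union>Y-{g k}. g k - y) = (\<Prod>j\<le>n. g k - f j) * (\<Prod>j\<in>{..n}-{k}. g k - g j)"
      using fin by (simp add: prod.union_disjoint prod.reindex[OF inj(2)]) (simp add: X_def prod.reindex[OF inj(1)])
    also have "(\<Prod>j\<le>n. g k - f j) = pochhammer (s + of_nat k) (Suc n)"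
      unfolding P[symmetric] f_def g_def by (simp add: algebra_simps)
    also have "(\<Prod>j\<in>{..n}-{k}. g k - g j) = (\<Prod>j\<in>{..n}-{k}. - (of_nat j - of_nat k))"
      by (simp add: g_def)
    \<comment> \<open>One sign for each of the \<open>n\<close> indices other than
      \<open>k\<close>.\<close>
    also have "\<dots> = (-1)^(n - 0) * ((-1)^k * fact k * fact (n - k))"
      using k prod_diff_of_nat[of k n, where 'a='a] by (subst prod_uminus) simp
    finally have E: "(\<Prod>y\<in>X\<union>Y-{g k}. g k - y) = 
       pochhammer (s + of_nat k) (Suc n) * ((-1)^n * ((-1)^k * fact k * fact (n - k)))" by simp
    define w where "w = s - a + of_nat k"
    have N: "a - g k = - w" by (simp add: g_def w_def)
    show "1 / (\<Prod>y\<in>X\<union>Y-{g k}. g k - y) / (a - g k) = 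
       (-1)^Suc n * ((-1)^k / (fact k * fact (n - k) * pochhammer (s + of_nat k) (Suc n)) / (s - a + of_nat k))"
      unfolding E N w_def[symmetric] by (cases "even n"; cases "even k") (simp_all add: mult_ac del: pochhammer_Suc)
  qed
  finally have "1 / (pochhammer a (Suc n) * ((-1)^Suc n * pochhammer (s - a) (Suc n))) =
    (-1)^Suc n * (\<Sum>k\<le>n. (-1)^k / (fact k * fact (n - k) * pochhammer (s + of_nat k) (Suc n)) *
      (1 / (a + of_nat k) + 1 / (s - a + of_nat k)))"
    unfolding sum_distrib_left sum.distrib[symmetric]
    by (simp only: distrib_left times_divide_eq_right mult_1_right)
  thus ?thesis
    by (cases "even n") (simp_all del: pochhammer_Suc)
qed

section \<open>Growth of binomial coefficients with complex upper index\<close>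

lemma pochhammer_over_fact_asymptotics:
  fixes z :: complex
  shows "(\<lambda>n. pochhammer z n / fact n * exp ((1 - z) * of_real (ln (real n)))) \<longlonglongrightarrow> rGamma z"
proof -
  \<comment> \<open>Up to the sign (-1)^n the quotient is the binomial coefficient of -z over
    \<open>n\<close>. The power of \<open>n\<close> is written with \<open>exp\<close> to match
    \<open>Gamma_series\<close> later.\<close>
  have "(\<lambda>n. (-z gchoose n) / ((-1)^n / exp ((-z+1) * of_real (ln (real n))))) \<longlonglongrightarrow> rGamma z"
    using gbinomial_asymptotic[of "-z"] by (simp add: rGamma_inverse_Gamma)
  also have "(\<lambda>n. (-z gchoose n) / ((-1)^n / exp ((-z+1) * of_real (ln (real n))))) =
      (\<lambda>n. pochhammer z n / fact n * exp ((1 - z) * of_real (ln (real n))))"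
    by (rule ext) (simp add: gbinomial_pochhammer divide_simps)
  finally show ?thesis .
qed

lemma norm_pochhammer_over_fact_le:
  fixes z :: complex
  obtains C where "C > 0" "\<And>n. n > 0 \<Longrightarrow> norm (pochhammer z n / fact n) \<le> C * real n powr (Re z - 1)"
proof -
  have "Bseq (\<lambda>n. pochhammer z n / fact n * exp ((1 - z) * of_real (ln (real n))))"
    using pochhammer_over_fact_asymptotics[of z] by (intro convergent_imp_Bseq convergentI)
  then obtain C where C: "C > 0" 
    "\<And>n. norm (pochhammer z n / fact n * exp ((1 - z) * of_real (ln (real n)))) \<le> C"
    by (elim BseqE) auto
  have "norm (pochhammer z n / fact n) \<le> C * real n powr (Re z - 1)" if n: "n > 0" for n
  proof -
    have "norm (pochhammer z n / fact n) = norm (pochhammer z n / fact n * exp ((1 - z) * of_real (ln (real n)))) 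
      * exp ((Re z - 1) * ln (real n))"
      by (simp add: norm_mult norm_divide mult_exp_exp algebra_simps)
    also have "\<dots> \<le> C * exp ((Re z - 1) * ln (real n))"
      by (intro mult_right_mono C) auto
    finally show ?thesis using n by (simp add: powr_def)
  qed
  with C(1) show ?thesis by (rule that)
qed

text \<open>Passing from \<open>n\<close> to \<open>Suc n\<close> includes n = 0. It uses n >= (n +
  1) / 2 and an exponent that is not positive, at the cost of the factor 2 powr (1 - Re z).\<close>

lemma norm_pochhammer_over_fact_le':
  fixes z :: complex
  assumes "Re z \<le> 1"
  obtains C where "C > 0" "\<And>n. norm (pochhammer z n / fact n) \<le> C * real (Suc n) powr (Re z - 1)"
proof -
  obtain C where C: "C > 0" "\<And>n. n > 0 \<Longrightarrow> norm (pochhammer z n / fact n) \<le> C * real n powr (Re z - 1)"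
    using norm_pochhammer_over_fact_le by blast
  define C' where "C' = max 1 (C * 2 powr (1 - Re z))"
  have "norm (pochhammer z n / fact n) \<le> C' * real (Suc n) powr (Re z - 1)" for n
  proof (cases "n = 0")
    case False
    have "real n powr (Re z - 1) \<le> (real (Suc n) / 2) powr (Re z - 1)"
      using False assms by (intro powr_mono2') auto
    also have "\<dots> = real (Suc n) powr (Re z - 1) * 2 powr (1 - Re z)"
      by (simp add: powr_divide powr_diff divide_simps flip: powr_add)
    finally have "C * real n powr (Re z - 1) \<le> C * (real (Suc n) powr (Re z - 1) * 2 powr (1 - Re z))"
      using C(1) by (intro mult_left_mono) auto
    also have "\<dots> \<le> C' * real (Suc n) powr (Re z - 1)"
      using mult_right_mono[of "C * 2 powr (1 - Re z)" C' "real (Suc n) powr (Re z - 1)"]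
      by (simp add: C'_def mult_ac)
    finally show ?thesis using C(2)[of n] False by force
  qed (auto simp: C'_def)
  moreover have "C' > 0" by (simp add: C'_def)
  ultimately show ?thesis using that by blast
qed

lemma abs_summable_pochhammer_over_fact:
  fixes z :: complex
  assumes "Re z < 0"
  shows "summable (\<lambda>n. norm (pochhammer z n / fact n))"
proof -
  obtain C where C: "C > 0" "\<And>n. norm (pochhammer z n / fact n) \<le> C * real (Suc n) powr (Re z - 1)"
    using norm_pochhammer_over_fact_le'[of z] assms by auto
  have "summable (\<lambda>n. real n powr (Re z - 1))"
    using assms by (simp add: summable_real_powr_iff)
  hence "summable (\<lambda>n. C * real (Suc n) powr (Re z - 1))"
    by (subst (asm) summable_Suc_iff[symmetric]) (rule summable_mult)
  thus ?thesis
    by (rule summable_comparison_test_ev[rotated]) (use C(2) in auto)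
qed

text \<open>The binomial series of (1 - x) powr (-z) at the boundary point x = 1. The partial sums
  telescope to \<open>pochhammer (z + 1) n / fact n\<close>, which is O(n powr Re z).\<close>

lemma pochhammer_over_fact_sums_0:
  fixes z :: complex
  assumes "Re z < 0"
  shows "(\<lambda>n. pochhammer z n / fact n) sums 0"
proof -
  have eq: "(\<Sum>k\<le>n. pochhammer z k / fact k) = pochhammer (z + 1) n / fact n" for n
  proof (induction n)
    case (Suc n)
    have "pochhammer z (Suc n) = z * pochhammer (z + 1) n"
      by (rule pochhammer_rec)
    hence "pochhammer (z + 1) n / fact n + pochhammer z (Suc n) / fact (Suc n) = 
        pochhammer (z + 1) (Suc n) / fact (Suc n)"
      by (simp add: divide_simps pochhammer_Suc del: of_nat_Suc) (simp add: algebra_simps)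
    thus ?case using Suc.IH by simp
  qed auto
  obtain C where C: "C > 0" "\<And>n. norm (pochhammer (z+1) n / fact n) \<le> C * real (Suc n) powr (Re z)"
    using norm_pochhammer_over_fact_le'[of "z+1"] assms by auto
  have "(\<lambda>n. pochhammer (z + 1) n / fact n) \<longlonglongrightarrow> 0"
  proof (rule Lim_null_comparison)
    show "\<forall>\<^sub>F n in sequentially. norm (pochhammer (z + 1) n / fact n) \<le> C * real (Suc n) powr (Re z)"
      using C(2) by auto
    show "(\<lambda>n. C * real (Suc n) powr (Re z)) \<longlonglongrightarrow> 0"
      using assms by real_asymp
  qed
  thus ?thesis unfolding sums_def_le eq .
qed

lemma bounded_inverse_add_of_nat:
  fixes a :: complex
  obtains C where "C > 0" "\<And>n. norm (1 / (a + of_nat n)) \<le> C"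
proof -
  have "(\<lambda>n. inverse (a + of_nat n)) \<longlonglongrightarrow> 0"
    by (intro filterlim_compose[OF tendsto_inverse_0] tendsto_add_filterlim_at_infinity[OF tendsto_const] tendsto_of_nat)
  hence "Bseq (\<lambda>n. 1 / (a + of_nat n))"
    by (intro convergent_imp_Bseq convergentI) (simp add: divide_inverse)
  thus ?thesis using that by (elim BseqE) auto
qed

text \<open>
  Both expansions arise as limits of partial fractions of Euler's finite approximations to the Gamma
  function, where the interchange of limit and sum is Tannery's theorem.
\<close>

lemma Gamma_quotient_sums:
  fixes a s :: complex
  assumes s: "Re s < 0" and a: "a \<notin> \<int>\<^sub>\<le>\<^sub>0"
  shows "(\<lambda>k. pochhammer s k / fact k / (a + of_nat k)) sums (Gamma (1 - s) * (Gamma a * rGamma (a + 1 - s)))"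
proof -
  define b where "b = 1 - s"
  have b: "Re b > 1" using s by (simp add: b_def)
  hence b': "b \<notin> \<int>\<^sub>\<le>\<^sub>0" by (auto elim!: nonpos_Ints_cases)
  define c where "c = (\<lambda>k. pochhammer s k / fact k)"
  define E where "E = (\<lambda>n z. exp (z * of_real (ln (real n))) :: complex)"
  \<comment> \<open>The \<open>k\<close>-th summand of the partial fractions at stage
    \<open>n\<close>, scaled by n powr (1 - b) and extended by 0 beyond k = n, so that each stage is
    a series over all \<open>k\<close> as Tannery's theorem requires.\<close>
  define t where "t k n = (if k \<le> n then c k / (a + of_nat k) * (pochhammer b (n - k) / fact (n - k) * E n (1 - b)) else 0)" for k n

  \<comment> \<open>The asymptotics hold at n - k; replacing the power of n - k by that of
    \<open>n\<close> costs a factor tending to 1.\<close>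
  have lim1: "(\<lambda>n. pochhammer b (n - k) / fact (n - k) * E n (1 - b)) \<longlonglongrightarrow> rGamma b" for k
  proof -
    have "(\<lambda>n. pochhammer b (n - k) / fact (n - k) * exp ((1 - b) * of_real (ln (real (n - k))))) \<longlonglongrightarrow> rGamma b"
      using filterlim_compose[OF pochhammer_over_fact_asymptotics[of b] filterlim_minus_const_nat_at_top[of k]] by simp
    moreover have "(\<lambda>n. exp ((1 - b) * of_real (ln (real n) - ln (real n - real k)))) \<longlonglongrightarrow> exp ((1 - b) * of_real 0)"
      by (intro tendsto_intros) real_asymp
    ultimately have "(\<lambda>n. pochhammer b (n - k) / fact (n - k) * exp ((1 - b) * of_real (ln (real (n - k)))) *
         exp ((1 - b) * of_real (ln (real n) - ln (real n - real k)))) \<longlonglongrightarrow> rGamma b * exp ((1 - b) * of_real 0)"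
      by (rule tendsto_mult)
    also have "?this \<longleftrightarrow> ?thesis"
    proof (intro tendsto_cong_limit filterlim_cong refl)
      show "\<forall>\<^sub>F n in sequentially. pochhammer b (n - k) / fact (n - k) * exp ((1 - b) * of_real (ln (real (n - k)))) *
         exp ((1 - b) * of_real (ln (real n) - ln (real n - real k))) = 
         pochhammer b (n - k) / fact (n - k) * E n (1 - b)"
        using eventually_gt_at_top[of k] 
        by eventually_elim (simp add: E_def mult_exp_exp of_nat_diff algebra_simps)
    qed auto
    finally show ?thesis .
  qed

  obtain C where C: "C > 0" "\<And>n. n > 0 \<Longrightarrow> norm (pochhammer b n / fact n) \<le> C * real n powr (Re b - 1)"
    using norm_pochhammer_over_fact_le by blast
  obtain C' where C': "C' > 0" "\<And>n. norm (1 / (a + of_nat n)) \<le> C'"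
    using bounded_inverse_add_of_nat by blast
  have bnd: "norm (t k n) \<le> norm (c k) * (C' * max C 1)" if n: "n > 0" for k n
  proof (cases "k \<le> n")
    case True
    have nE: "norm (E n (1 - b)) = real n powr (1 - Re b)"
      using n by (simp add: E_def powr_def)
    \<comment> \<open>The 1 in \<open>max C 1\<close> is for k = n: there the quotient is 1, while a
      bound by a power of n - k would be 0.\<close>
    have "norm (pochhammer b (n - k) / fact (n - k)) \<le> max C 1 * real n powr (Re b - 1)"
    proof (cases "n = k")
      case False
      hence "norm (pochhammer b (n - k) / fact (n - k)) \<le> C * real (n - k) powr (Re b - 1)"
        using C(2)[of "n - k"] True by simp
      also have "\<dots> \<le> max C 1 * real n powr (Re b - 1)"
        using b by (intro mult_mono powr_mono2) auto
      finally show ?thesis .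
    next
      case True
      have "1 * 1 \<le> max C 1 * real n powr (Re b - 1)"
        using n b by (intro mult_mono ge_one_powr_ge_zero) auto
      thus ?thesis using True by simp
    qed
    hence "norm (pochhammer b (n - k) / fact (n - k) * E n (1 - b)) \<le> max C 1 * real n powr (Re b - 1) * real n powr (1 - Re b)"
      unfolding norm_mult nE by (intro mult_right_mono) auto
    also have "\<dots> = max C 1" using n by (simp add: mult.assoc flip: powr_add)
    finally have "norm (c k) * norm (1 / (a + of_nat k)) * norm (pochhammer b (n - k) / fact (n - k) * E n (1 - b)) \<le> 
       norm (c k) * C' * max C 1"
      using C' by (intro mult_mono) auto
    thus ?thesis using True by (simp add: t_def norm_mult norm_divide mult_ac)
  next
    case False
    thus ?thesis using C C' by (simp add: t_def)
  qed

  have summ: "summable (\<lambda>k. norm (c k) * (C' * max C 1))"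
    unfolding c_def by (intro summable_mult2 abs_summable_pochhammer_over_fact s)
  have tan: "(\<lambda>n. suminf (\<lambda>k. t k n)) \<longlonglongrightarrow> suminf (\<lambda>k. c k / (a + of_nat k) * rGamma b) \<and>
     summable (\<lambda>k. norm (c k / (a + of_nat k) * rGamma b))"
  proof -
    have "(\<lambda>n. t k n) \<longlonglongrightarrow> c k / (a + of_nat k) * rGamma b" for k
    proof -
      have "\<forall>\<^sub>F n in sequentially. c k / (a + of_nat k) * (pochhammer b (n - k) / fact (n - k) * E n (1 - b)) = t k n"
        using eventually_ge_at_top[of k] by eventually_elim (simp add: t_def)
      thus ?thesis 
        by (rule Lim_transform_eventually[rotated]) (intro tendsto_mult tendsto_const lim1)
    qed
    moreover have "\<forall>\<^sub>F (k, n) in sequentially \<times>\<^sub>F sequentially. norm (t k n) \<le> norm (c k) * (C' * max C 1)"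
    proof -
      have "\<forall>\<^sub>F x in sequentially \<times>\<^sub>F sequentially. snd x > (0::nat)"
        by (rule eventually_compose_filterlim[OF eventually_gt_at_top filterlim_snd])
      thus ?thesis by eventually_elim (auto intro: bnd)
    qed
    ultimately show ?thesis using summ by (intro conjI tannerys_theorem[THEN conjunct2, THEN conjunct2] tannerys_theorem[THEN conjunct2, THEN conjunct1]) auto
  qed

  have fin: "suminf (\<lambda>k. t k n) = E n (1 - b) * (pochhammer (a + b) n / pochhammer a (Suc n))" for n
  proof -
    have "suminf (\<lambda>k. t k n) = (\<Sum>k\<le>n. t k n)"
      by (intro suminf_finite) (auto simp: t_def)
    also have "\<dots> = (\<Sum>k\<le>n. E n (1 - b) * (pochhammer (b - of_nat k) n / ((-1)^k * fact k * fact (n - k)) / (a + of_nat k)))"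
    proof (intro sum.cong refl)
      fix k assume k: "k \<in> {..n}"
      have "pochhammer (b - of_nat k) n = pochhammer (b - of_nat k) (k + (n - k))" using k by simp
      also have "\<dots> = pochhammer (b - of_nat k) k * pochhammer b (n - k)"
        by (subst pochhammer_product') simp
      \<comment> \<open>The factors run from 1 - s - k up to -s; reversing them gives those of
        \<open>pochhammer s k\<close> with a sign each. This sign cancels the one in the
        denominator.\<close>
      also have "pochhammer (b - of_nat k) k = (-1)^k * pochhammer s k"
        using pochhammer_minus'[of s k] pochhammer_minus[of "b - 1" k] by (simp add: b_def algebra_simps)
      finally show "t k n = E n (1 - b) * (pochhammer (b - of_nat k) n / ((-1)^k * fact k * fact (n - k)) / (a + of_nat k))"
        using k by (simp add: t_def c_def mult_ac)
    qed
    also have "\<dots> = E n (1 - b) * (pochhammer (a + b) n / pochhammer a (Suc n))"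
      unfolding sum_distrib_left[symmetric] using a by (subst pochhammer_quotient_partial_fractions) auto
    finally show ?thesis .
  qed
  \<comment> \<open>The closed form at stage \<open>n\<close> splits into the binomial asymptotics
    at a + b and Euler's approximation to \<open>Gamma a\<close>; the powers of \<open>n\<close>
    combine to n powr (1 - b).\<close>
  have "(\<lambda>n. (pochhammer (a + b) n / fact n * exp ((1 - (a + b)) * of_real (ln (real n)))) * Gamma_series a n) 
      \<longlonglongrightarrow> rGamma (a + b) * Gamma a"
    by (intro tendsto_mult pochhammer_over_fact_asymptotics Gamma_series_LIMSEQ)
  also have "(\<lambda>n. (pochhammer (a + b) n / fact n * exp ((1 - (a + b)) * of_real (ln (real n)))) * Gamma_series a n)
      = (\<lambda>n. E n (1 - b) * (pochhammer (a + b) n / pochhammer a (Suc n)))"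
  proof
    fix n
    have "E n (1 - b) = exp ((1 - (a + b)) * of_real (ln (real n))) * exp (a * of_real (ln (real n)))"
      by (simp add: E_def mult_exp_exp algebra_simps)
    moreover have "x / f * e * (f * e' / p) = e * e' * (x / p)" if "f \<noteq> 0" for x f e e' p :: complex
      using that by simp
    ultimately show "(pochhammer (a + b) n / fact n * exp ((1 - (a + b)) * of_real (ln (real n)))) * Gamma_series a n
      = E n (1 - b) * (pochhammer (a + b) n / pochhammer a (Suc n))"
      by (simp only: Gamma_series_def Suc_eq_plus1 fact_nonzero not_False_eq_True)
  qed
  finally have "suminf (\<lambda>k. c k / (a + of_nat k) * rGamma b) = rGamma (a + b) * Gamma a"
    using tan unfolding fin by (intro LIMSEQ_unique) auto
  moreover have "summable (\<lambda>k. c k / (a + of_nat k) * rGamma b)"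
    by (rule summable_norm_cancel) (use tan in simp)
  ultimately have "(\<lambda>k. c k / (a + of_nat k) * rGamma b) sums (rGamma (a + b) * Gamma a)"
    unfolding sums_iff by blast
  hence "(\<lambda>k. Gamma b * (c k / (a + of_nat k) * rGamma b)) sums (Gamma b * (rGamma (a + b) * Gamma a))"
    by (rule sums_mult)
  also have "(\<lambda>k. Gamma b * (c k / (a + of_nat k) * rGamma b)) = (\<lambda>k. c k / (a + of_nat k))"
    using b' by (auto simp: rGamma_inverse_Gamma Gamma_eq_zero_iff)
  finally show ?thesis
    unfolding c_def b_def add_diff_eq by (simp only: mult.commute)
qed

text \<open>The lower bound on \<open>Re s\<close> keeps the correction factors of the finite stages
  at most 1 in modulus, and the upper bound makes the coefficients absolutely summable. Together
  they give the majorant for Tannery's theorem.\<close>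

lemma Gamma_mult_sums:
  fixes a s :: complex
  assumes s: "-1 < Re s" "Re s < 0" and a: "a \<notin> \<int>\<^sub>\<le>\<^sub>0" "s - a \<notin> \<int>\<^sub>\<le>\<^sub>0"
  shows "(\<lambda>k. (-1)^k * (pochhammer s k / fact k) * (1 / (a + of_nat k) + 1 / (s - a + of_nat k))) sums 
     (Gamma a * Gamma (s - a) * rGamma s)"
proof -
  have s': "s \<notin> \<int>\<^sub>\<le>\<^sub>0" 
  proof
    assume "s \<in> \<int>\<^sub>\<le>\<^sub>0"
    then obtain n where "s = of_int n" by (auto elim: nonpos_Ints_cases)
    thus False using s by auto
  qed
  define c where "c = (\<lambda>k. (-1)^k * (pochhammer s k / fact k) * (1 / (a + of_nat k) + 1 / (s - a + of_nat k)))"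
  \<comment> \<open>The ratio of the \<open>k\<close>-th coefficient at stage \<open>n\<close>,
    after scaling by \<open>fact n * pochhammer s (Suc n)\<close>, to its limit.\<close>
  define r where "r k n = (\<Prod>j<k. (of_nat n - of_nat j) / (s + of_nat n + 1 + of_nat j))" for k n
  define t where "t k n = (if k \<le> n then c k * r k n else 0)" for k n
  have r_lim: "(\<lambda>n. r k n) \<longlonglongrightarrow> 1" for k
  proof -
    have "(\<lambda>n. r k n) \<longlonglongrightarrow> (\<Prod>j<k. 1)"
      unfolding r_def
    proof (intro tendsto_prod)
      fix j
      have "(\<lambda>n. inverse (s + 1 + of_nat j + of_nat n)) \<longlonglongrightarrow> 0"
        by (intro filterlim_compose[OF tendsto_inverse_0] tendsto_add_filterlim_at_infinity[OF tendsto_const] tendsto_of_nat)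
      hence "(\<lambda>n. 1 - (s + 1 + 2 * of_nat j) * inverse (s + 1 + of_nat j + of_nat n)) \<longlonglongrightarrow> 1 - (s + 1 + 2 * of_nat j) * 0"
        by (intro tendsto_intros)
      also have "(\<lambda>n. 1 - (s + 1 + 2 * of_nat j) * inverse (s + 1 + of_nat j + of_nat n)) =
         (\<lambda>n. (of_nat n - of_nat j) / (s + of_nat n + 1 + of_nat j))"
      proof
        fix n
        have "s + of_nat (n + 1 + j) \<noteq> 0" by (rule not_nonpos_Ints_add_of_nat[OF s'])
        thus "1 - (s + 1 + 2 * of_nat j) * inverse (s + 1 + of_nat j + of_nat n) =
           (of_nat n - of_nat j) / (s + of_nat n + 1 + of_nat j)"
          by (simp add: divide_simps add_ac)
      qed
      finally show "(\<lambda>n. (of_nat n - of_nat j) / (s + of_nat n + 1 + of_nat j)) \<longlonglongrightarrow> 1" by simp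
    qed
    thus ?thesis by simp
  qed
  have r_bnd: "norm (r k n) \<le> 1" if "k \<le> n" for k n
    unfolding r_def prod_norm[symmetric]
  proof (intro prod_le_1 conjI)
    fix j assume j: "j \<in> {..<k}"
    have "norm (of_nat n - of_nat j :: complex) = real (n - j)"
      using j that by (metis of_nat_diff lessThan_iff less_imp_le norm_of_nat order.trans)
    also have "\<dots> \<le> Re (s + of_nat n + 1 + of_nat j)" using s by simp
    also have "\<dots> \<le> norm (s + of_nat n + 1 + of_nat j)" by (rule complex_Re_le_cmod)
    finally show "norm ((of_nat n - of_nat j) / (s + of_nat n + 1 + of_nat j)) \<le> 1"
      by (simp add: norm_divide divide_simps)
  qed auto
  obtain C where C: "C > 0" "\<And>n. norm (1 / (a + of_nat n)) \<le> C"
    using bounded_inverse_add_of_nat by blast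
  obtain C' where C': "C' > 0" "\<And>n. norm (1 / (s - a + of_nat n)) \<le> C'"
    using bounded_inverse_add_of_nat by blast
  have c_bnd: "norm (c k) \<le> norm (pochhammer s k / fact k) * (C + C')" for k
    unfolding c_def norm_mult
    using norm_triangle_mono[OF C(2)[of k] C'(2)[of k]]
    by (intro mult_mono) (auto simp: norm_power)
  have summ: "summable (\<lambda>k. norm (pochhammer s k / fact k) * (C + C'))"
    by (intro summable_mult2 abs_summable_pochhammer_over_fact s)
  have t_bnd: "norm (t k n) \<le> norm (pochhammer s k / fact k) * (C + C')" for k n
    using mult_mono[OF c_bnd[of k] r_bnd[of k n]] C(1) C'(1) by (auto simp: t_def norm_mult)
  have tan: "(\<lambda>n. suminf (\<lambda>k. t k n)) \<longlonglongrightarrow> suminf c \<and> summable (\<lambda>k. norm (c k))"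
  proof -
    have "(\<lambda>n. t k n) \<longlonglongrightarrow> c k" for k
    proof -
      have "\<forall>\<^sub>F n in sequentially. c k * r k n = t k n"
        using eventually_ge_at_top[of k] by eventually_elim (simp add: t_def)
      moreover have "(\<lambda>n. c k * r k n) \<longlonglongrightarrow> c k * 1" by (intro tendsto_intros r_lim)
      ultimately show ?thesis by (auto intro: Lim_transform_eventually)
    qed
    moreover have "\<forall>\<^sub>F (k, n) in sequentially \<times>\<^sub>F sequentially. norm (t k n) \<le> norm (pochhammer s k / fact k) * (C + C')"
      using t_bnd by (intro always_eventually) auto
    ultimately show ?thesis using summ by (intro conjI tannerys_theorem[THEN conjunct2, THEN conjunct2] tannerys_theorem[THEN conjunct2, THEN conjunct1]) auto
  qed
  have fin: "suminf (\<lambda>k. t k n) = fact n * pochhammer s (Suc n) / (pochhammer a (Suc n) * pochhammer (s - a) (Suc n))" for n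
  proof -
    have "suminf (\<lambda>k. t k n) = (\<Sum>k\<le>n. t k n)"
      by (intro suminf_finite) (auto simp: t_def)
    also have "\<dots> = (\<Sum>k\<le>n. fact n * pochhammer s (Suc n) * ((-1)^k / (fact k * fact (n - k) * pochhammer (s + of_nat k) (Suc n)) *
      (1 / (a + of_nat k) + 1 / (s - a + of_nat k))))"
    proof (intro sum.cong refl)
      fix k assume k: "k \<in> {..n}"
      have nz: "pochhammer (s + of_nat j) i \<noteq> 0" for i j
      proof
        assume "pochhammer (s + of_nat j) i = 0"
        then obtain l where "s + of_nat j = - of_nat l" by (auto simp: pochhammer_eq_0_iff)
        hence "s + of_nat (j + l) = 0" by (simp add: add.assoc[symmetric])
        thus False using not_nonpos_Ints_add_of_nat[OF s'] by blast
      qed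
      have nz': "pochhammer s i \<noteq> 0" for i using nz[of 0 i] by simp
      \<comment> \<open>Splitting the product of k + n + 1 factors after \<open>k\<close> and after
        n + 1 factors isolates the dependence on \<open>k\<close> in a quotient that tends to 1
        together with the factorials.\<close>
      have "pochhammer s k * pochhammer (s + of_nat k) (Suc n) = pochhammer s (k + Suc n)"
        by (rule pochhammer_product'[symmetric])
      also have "\<dots> = pochhammer s (Suc n + k)" by (simp only: add.commute)
      also have "\<dots> = pochhammer s (Suc n) * pochhammer (s + of_nat (Suc n)) k"
        by (rule pochhammer_product')
      finally have E1: "pochhammer s k / pochhammer (s + of_nat (Suc n)) k = pochhammer s (Suc n) / pochhammer (s + of_nat k) (Suc n)"
        using nz by (simp add: divide_simps del: pochhammer_Suc of_nat_Suc)
      have "(\<Prod>j<k. of_nat n - of_nat j :: complex) = fact n / fact (n - k)"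
      proof -
        have "(\<Prod>j<k. of_nat n - of_nat j :: complex) = of_nat (\<Prod>j<k. n - j)"
          using k by (simp add: of_nat_diff)
        also have "(\<Prod>j<k. n - j) = (\<Prod>{n - k + 1..n})"
          using k by (intro prod.reindex_bij_witness[of _ "\<lambda>i. n - i" "\<lambda>j. n - j"]) auto
        also have "\<dots> = fact n div fact (n - k)"
          using k by (simp add: fact_div_fact)
        also have "of_nat \<dots> = (fact n / fact (n - k) :: complex)"
        proof -
          have "(fact n div fact (n - k)) * fact (n - k) = (fact n :: nat)" by (simp add: fact_dvd)
          hence "of_nat (fact n div fact (n - k)) * fact (n - k) = (fact n :: complex)"
            by (metis of_nat_fact of_nat_mult)
          thus ?thesis by (simp add: field_simps)
        qed
        finally show ?thesis .
      qed
      hence "r k n = fact n / fact (n - k) / pochhammer (s + of_nat (Suc n)) k"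
        by (simp add: r_def prod_dividef pochhammer_prod atLeast0LessThan add_ac)
      hence "pochhammer s k * r k n = fact n / fact (n - k) * (pochhammer s k / pochhammer (s + of_nat (Suc n)) k)"
        by (simp del: of_nat_Suc)
      also note E1
      finally have E2: "pochhammer s k * r k n = fact n / fact (n - k) * (pochhammer s (Suc n) / pochhammer (s + of_nat k) (Suc n))" .
      define w where "w = 1 / (a + of_nat k) + 1 / (s - a + of_nat k)"
      have "t k n = (-1)^k / fact k * w * (pochhammer s k * r k n)"
        using k by (simp add: t_def c_def w_def)
      thus "t k n = fact n * pochhammer s (Suc n) * ((-1)^k / (fact k * fact (n - k) * pochhammer (s + of_nat k) (Suc n)) *
          (1 / (a + of_nat k) + 1 / (s - a + of_nat k)))"
        unfolding E2 w_def[symmetric] by (simp add: mult_ac del: pochhammer_Suc)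
    qed
    also have "\<dots> = fact n * pochhammer s (Suc n) * (1 / (pochhammer a (Suc n) * pochhammer (s - a) (Suc n)))"
      unfolding sum_distrib_left[symmetric] using a s' by (subst inverse_pochhammer_mult_partial_fractions) auto
    finally show ?thesis by simp
  qed
  \<comment> \<open>The powers of \<open>n\<close> with exponents a, s - a and -s cancel, which
    explains the scaling used at stage \<open>n\<close>.\<close>
  have "(\<lambda>n. Gamma_series a n * Gamma_series (s - a) n * rGamma_series s n) \<longlonglongrightarrow> Gamma a * Gamma (s - a) * rGamma s"
    by (intro tendsto_mult rGamma_series_LIMSEQ Gamma_series_LIMSEQ)
  also have "(\<lambda>n. Gamma_series a n * Gamma_series (s - a) n * rGamma_series s n) = 
     (\<lambda>n. fact n * pochhammer s (Suc n) / (pochhammer a (Suc n) * pochhammer (s - a) (Suc n)))"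
  proof
    fix n
    have "exp (s * of_real (ln (real n))) = exp (a * of_real (ln (real n))) * exp ((s - a) * of_real (ln (real n)))"
      by (simp add: mult_exp_exp algebra_simps)
    moreover have "f * e / p * (f * e' / p') * (x / (f * (e * e'))) = f * x / (p * p')"
      if "f \<noteq> 0" "e \<noteq> 0" "e' \<noteq> 0" for x f e e' p p' :: complex
      using that by simp
    ultimately show "Gamma_series a n * Gamma_series (s - a) n * rGamma_series s n = 
      fact n * pochhammer s (Suc n) / (pochhammer a (Suc n) * pochhammer (s - a) (Suc n))"
      by (simp only: Gamma_series_def rGamma_series_def Suc_eq_plus1 fact_nonzero exp_not_eq_zero not_False_eq_True)
  qed
  finally have "suminf c = Gamma a * Gamma (s - a) * rGamma s"
    using tan unfolding fin by (intro LIMSEQ_unique) auto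
  moreover have "summable c"
    by (rule summable_norm_cancel) (use tan in simp)
  ultimately show ?thesis
    unfolding sums_iff c_def by blast
qed

section \<open>Partial fractions of hyperbolic functions\<close>

text \<open>The logarithmic derivative of Euler's reflection formula Gamma z * Gamma (1 - z) = pi /
  sin (pi z).\<close>

lemma Digamma_reflection:
  fixes z :: complex
  assumes z: "z \<notin> \<int>"
  shows "Digamma (1 - z) - Digamma z = of_real pi * cot (of_real pi * z)"
proof -
  have z': "z \<notin> \<int>\<^sub>\<le>\<^sub>0" "1 - z \<notin> \<int>\<^sub>\<le>\<^sub>0"
    using z by (auto dest!: nonpos_Ints_Int)
  have sin: "sin (of_real pi * z) \<noteq> 0"
    using z by (auto simp: sin_eq_0 mult_ac)
  have "((\<lambda>z. Gamma z * Gamma (1 - z)) has_field_derivative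
      (Gamma z * Gamma (1 - z) * (Digamma z - Digamma (1 - z)))) (at z)"
    using z' by (auto intro!: derivative_eq_intros simp: algebra_simps)
  moreover have "(\<lambda>z::complex. Gamma z * Gamma (1 - z)) = (\<lambda>z. of_real pi / sin (of_real pi * z))"
    by (intro ext Gamma_reflection_complex)
  moreover have "((\<lambda>z. of_real pi / sin (of_real pi * z)) has_field_derivative 
      (- (of_real pi / sin (of_real pi * z)) * (of_real pi * cot (of_real pi * z)))) (at z)"
    using sin by (auto intro!: derivative_eq_intros simp: cot_def field_simps power2_eq_square)
  ultimately have "of_real pi / sin (of_real pi * z) * (Digamma z - Digamma (1 - z)) = 
      (- (of_real pi / sin (of_real pi * z)) * (of_real pi * cot (of_real pi * z)))"
    by (metis DERIV_unique)
  hence "of_real pi / sin (of_real pi * z) * (Digamma z - Digamma (1 - z)) = 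
      of_real pi / sin (of_real pi * z) * (- (of_real pi * cot (of_real pi * z)))"
    by simp
  hence "Digamma z - Digamma (1 - z) = - (of_real pi * cot (of_real pi * z))"
    by (subst (asm) mult_left_cancel) (use sin in auto)
  thus ?thesis by (simp add: algebra_simps)
qed

text \<open>In the difference of two Digamma series the harmonic terms and Euler's constant cancel,
  and the remaining summands are O(1 / n^2). Hence the sum is unconditional.\<close>

lemma has_sum_Digamma_diff:
  fixes z w :: complex
  assumes "z \<noteq> 0" "w \<noteq> 0"
  shows "((\<lambda>n. 1 / (z + of_nat n) - 1 / (w + of_nat n)) has_sum (Digamma w - Digamma z)) UNIV"
proof (rule norm_summable_imp_has_sum)
  have "(\<lambda>n. inverse (of_nat (Suc n)) - inverse (u + of_nat n)) sums (Digamma u + euler_mascheroni)" 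
    if "u \<noteq> 0" for u :: complex
    using summable_sums[OF summable_Digamma[OF that]] by (simp add: Digamma_def)
  from sums_diff[OF this[OF assms(2)] this[OF assms(1)]]
  show "(\<lambda>n. 1 / (z + of_nat n) - 1 / (w + of_nat n)) sums (Digamma w - Digamma z)"
    by (simp add: divide_inverse)
next
  \<comment> \<open>From this point on, adding \<open>z\<close> or \<open>w\<close> to
    \<open>n\<close> leaves a modulus of at least n / 2.\<close>
  define N where "N = 2 * (norm z + norm w) + 1"
  have "\<forall>\<^sub>F n in sequentially. real n \<ge> N"
    by real_asymp
  hence "\<forall>\<^sub>F n in sequentially. norm (norm (1 / (z + of_nat n) - 1 / (w + of_nat n))) \<le> norm (w - z) * 4 * inverse (real n ^ 2)"
  proof eventually_elim
    case (elim n)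
    have "0 < N" by (simp add: N_def add_nonneg_pos)
    hence n: "real n > 0" using elim by linarith
    have *: "real n / 2 \<le> norm (u + of_nat n)" if "norm u \<le> norm z + norm w" for u :: complex
      using norm_diff_ineq[of "of_nat n" u] that elim by (simp add: N_def add_ac)
    have z: "real n / 2 \<le> norm (z + of_nat n)" and w: "real n / 2 \<le> norm (w + of_nat n)"
      by (rule *; simp)+
    have nz: "z + of_nat n \<noteq> 0" "w + of_nat n \<noteq> 0" using z w n by auto
    have "norm (1 / (z + of_nat n) - 1 / (w + of_nat n)) = norm (w - z) / (norm (z + of_nat n) * norm (w + of_nat n))"
      using nz by (simp add: divide_simps norm_divide norm_mult[symmetric])
    also have "\<dots> \<le> norm (w - z) / (real n / 2 * (real n / 2))"
      using n nz by (intro divide_left_mono mult_mono z w mult_pos_pos) auto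
    also have "\<dots> = norm (w - z) * 4 * inverse (real n ^ 2)"
      using n by (simp add: field_simps power2_eq_square)
    finally show ?case by simp
  qed
  moreover have "summable (\<lambda>n. norm (w - z) * 4 * inverse (real n ^ 2))"
    by (intro summable_mult inverse_power_summable) auto
  ultimately show "summable (\<lambda>n. norm (1 / (z + of_nat n) - 1 / (w + of_nat n)))"
    by (rule summable_comparison_test_ev)
qed

text \<open>The terms with m <= 0 form a Digamma series at \<open>z\<close> and \<open>w\<close>,
  those with m > 0 one at 1 - z and 1 - w; reflection joins the two halves. Comparing two points
  replaces the symmetric summation that the cotangent series alone would need.\<close>

lemma has_sum_cot_partial_fractions:
  fixes z w :: complex
  assumes z: "z \<notin> \<int>" and w: "w \<notin> \<int>"
  shows "((\<lambda>m::int. 1 / (z - of_int m) - 1 / (w - of_int m)) has_sum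
           (of_real pi * cot (of_real pi * z) - of_real pi * cot (of_real pi * w))) UNIV"
proof -
  let ?f = "\<lambda>m::int. 1 / (z - of_int m) - 1 / (w - of_int m)"
  have nz: "z \<noteq> 0" "w \<noteq> 0" "1 - z \<noteq> 0" "1 - w \<noteq> 0" using z w by auto
  have eq: "-(1 / (1 - u + of_nat n)) = 1 / (u - of_int (int n + 1))" for u :: complex and n
  proof -
    have "1 - u + of_nat n = - (u - of_int (int n + 1))" by simp
    thus ?thesis by (simp only: divide_minus_right minus_minus)
  qed
  have "((?f \<circ> (\<lambda>n. - int n)) has_sum (Digamma w - Digamma z)) UNIV"
    using has_sum_Digamma_diff[OF nz(1,2)] by (simp add: o_def)
  hence 1: "(?f has_sum (Digamma w - Digamma z)) (range (\<lambda>n. - int n))"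
    by (subst has_sum_reindex) (auto simp: inj_on_def)
  have "((\<lambda>n. -(1 / (1 - z + of_nat n)) - -(1 / (1 - w + of_nat n))) has_sum (Digamma (1 - z) - Digamma (1 - w))) UNIV"
    using has_sum_Digamma_diff[OF nz(4,3)] by simp
  hence "((?f \<circ> (\<lambda>n. int n + 1)) has_sum (Digamma (1 - z) - Digamma (1 - w))) UNIV"
    unfolding eq by (simp add: o_def)
  hence 2: "(?f has_sum (Digamma (1 - z) - Digamma (1 - w))) (range (\<lambda>n. int n + 1))"
    by (subst has_sum_reindex) (auto simp: inj_on_def)
  have "range (\<lambda>n. - int n) \<inter> range (\<lambda>n. int n + 1) = {}" by auto
  from has_sum_Un_disjoint[OF 1 2 this]
  have "(?f has_sum ((Digamma (1 - z) - Digamma z) - (Digamma (1 - w) - Digamma w))) (range (\<lambda>n. - int n) \<union> range (\<lambda>n. int n + 1))"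
    by (simp add: algebra_simps)
  moreover have "range (\<lambda>n. - int n) \<union> range (\<lambda>n. int n + 1) = UNIV"
  proof (intro set_eqI iffI UNIV_I)
    fix m :: int
    show "m \<in> range (\<lambda>n. - int n) \<union> range (\<lambda>n. int n + 1)"
    proof (cases "m \<le> 0")
      case True
      hence "m = - int (nat (-m))" by simp
      thus ?thesis by blast
    next
      case False
      hence "m = int (nat (m - 1)) + 1" by simp
      thus ?thesis by blast
    qed
  qed
  ultimately show ?thesis by (simp only: Digamma_reflection[OF z] Digamma_reflection[OF w])
qed

text \<open>Since 1 / (exp (h x) - 1) is a multiple of a cotangent minus 1 / 2, the constant drops
  out of the difference, and the cotangent series is only rescaled by 2 pi i / h.\<close>

lemma has_sum_exp_partial_fractions:
  fixes x y :: complex and h :: real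
  assumes h: "h > 0" and x: "exp (of_real h * x) \<noteq> 1" and y: "exp (of_real h * y) \<noteq> 1"
  shows "((\<lambda>m::int. 1 / (x - 2 * of_real pi * \<i> * of_int m / of_real h) - 1 / (y - 2 * of_real pi * \<i> * of_int m / of_real h))
     has_sum (of_real h * (1 / (exp (of_real h * x) - 1) - 1 / (exp (of_real h * y) - 1)))) UNIV"
proof -
  define d where "d = 2 * of_real pi * \<i> / (of_real h :: complex)"
  have d: "d \<noteq> 0" using h by (simp add: d_def)
  have hd: "of_real h * d = 2 * of_real pi * \<i>" using h by (simp add: d_def)
  have nInt: "u / d \<notin> \<int>" if "exp (of_real h * u) \<noteq> 1" for u
  proof
    assume "u / d \<in> \<int>"
    then obtain m where "u / d = of_int m" by (auto elim: Ints_cases)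
    hence "u = d * of_int m" using d by (simp add: field_simps)
    hence "of_real h * u = of_int m * (of_real h * d)" by simp
    hence "of_real h * u = 2 * of_int m * of_real pi * \<i>" unfolding hd by (simp only: mult_ac)
    hence "exp (of_real h * u) = exp (2 * of_int m * of_real pi * \<i>)" by (rule arg_cong)
    also have "\<dots> = 1" by (subst exp_eq_1) (auto intro!: exI[of _ m])
    finally show False using that by simp
  qed
  have cot: "of_real pi / d * cot (of_real pi * (u / d)) = of_real h * (1 / 2 + 1 / (exp (of_real h * u) - 1))" 
    if "exp (of_real h * u) \<noteq> 1" for u
  proof -
    define v where "v = of_real h * u / 2"
    have pu: "of_real pi * (u / d) = - \<i> * v" and pd: "of_real pi / d = - \<i> * of_real h / 2"
      using h by (simp_all add: v_def d_def field_simps)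
    have e: "exp (of_real h * u) = exp v * exp v" 
      by (metis v_def exp_double divide_self_if div_by_1 mult_2 nonzero_mult_div_cancel_left power2_eq_square times_divide_eq_right zero_neq_numeral)
    have ne: "exp v * exp v \<noteq> 1" using that by (simp add: e)
    have c: "cos (- \<i> * v) = (exp v + exp (- v)) / 2" "sin (- \<i> * v) = (exp v - exp (- v)) / (2 * \<i>)"
      unfolding cos_exp_eq sin_exp_eq by (simp_all flip: mult.assoc)
    have "x / 2 / (y / (2 * \<i>)) = \<i> * x / y" for x y :: complex
      by (cases "y = 0") (simp_all add: field_simps)
    hence "cot (- \<i> * v) = \<i> * (exp v + exp (- v)) / (exp v - exp (- v))"
      unfolding cot_def c by blast
    also have "\<dots> = \<i> * (exp v * exp v + 1) / (exp v * exp v - 1)"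
      using ne by (simp add: exp_minus divide_simps)
    finally have cot: "cot (- \<i> * v) = \<i> * (exp v * exp v + 1) / (exp v * exp v - 1)" .
    show ?thesis
      unfolding pu pd e cot using ne by (simp add: divide_simps) (simp add: algebra_simps)
  qed
  have "((\<lambda>m::int. 1 / d * (1 / (x / d - of_int m) - 1 / (y / d - of_int m))) has_sum
           (1 / d * (of_real pi * cot (of_real pi * (x / d)) - of_real pi * cot (of_real pi * (y / d))))) UNIV"
    by (intro has_sum_cmult_right has_sum_cot_partial_fractions nInt x y)
  also have "1 / d * (of_real pi * cot (of_real pi * (x / d)) - of_real pi * cot (of_real pi * (y / d))) =
     of_real pi / d * cot (of_real pi * (x / d)) - of_real pi / d * cot (of_real pi * (y / d))"
    by (simp add: diff_divide_distrib)
  also have "\<dots> = of_real h * (1 / (exp (of_real h * x) - 1) - 1 / (exp (of_real h * y) - 1))"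
    unfolding cot[OF x] cot[OF y] by (simp add: ring_distribs)
  also have "(\<lambda>m::int. 1 / d * (1 / (x / d - of_int m) - 1 / (y / d - of_int m))) =
     (\<lambda>m. 1 / (x - d * of_int m) - 1 / (y - d * of_int m))"
  proof
    fix m :: int
    have *: "1 / d * (1 / (u / d - of_int m)) = 1 / (u - d * of_int m)" for u
    proof -
      have "d * (u / d - of_int m) = u - d * of_int m" using d by (simp add: right_diff_distrib)
      thus ?thesis by (metis mult_1 times_divide_times_eq)
    qed
    show "1 / d * (1 / (x / d - of_int m) - 1 / (y / d - of_int m)) = 1 / (x - d * of_int m) - 1 / (y - d * of_int m)"
      unfolding right_diff_distrib * ..
  qed
  finally show ?thesis by (simp add: d_def)
qed

text \<open>The value is h / sinh (h x / 2). The alternating series is twice its even part minus the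
  series without signs, and the even part is again a series without signs, with h / 2 in place of
  \<open>h\<close> because the step doubles.\<close>

lemma has_sum_csch_partial_fractions:
  fixes x :: complex and h :: real
  assumes h: "h > 0" and x: "exp (of_real h * x) \<noteq> 1"
  defines "d \<equiv> 2 * of_real pi * \<i> / of_real h"
  shows "((\<lambda>m::int. (-1) powi m * (1 / (x - d * of_int m) + 1 / (x + d * of_int m)))
     has_sum (2 * of_real h * exp (of_real h * x / 2) / (exp (of_real h * x) - 1))) UNIV"
proof -
  define f where "f = (\<lambda>m::int. 1 / (x - d * of_int m) + 1 / (x + d * of_int m))"
  define E where "E = exp (of_real h * x / 2)"
  have E: "exp (of_real h * x) = E * E" 
  proof -
    have "exp (of_real h * x / 2 + of_real h * x / 2) = E * E"
      unfolding exp_add E_def ..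
    moreover have "w / 2 + w / 2 = w" for w :: complex by simp
    ultimately show ?thesis by metis
  qed
  \<comment> \<open>The preceding partial fractions with y = -x, for any positive \<open>h\<close>
    because both \<open>h\<close> and h / 2 are needed.\<close>
  have symm: "((\<lambda>m::int. 1 / (x - 2 * of_real pi * \<i> / of_real h * of_int m) + 1 / (x + 2 * of_real pi * \<i> / of_real h * of_int m))
     has_sum (of_real h * ((exp (of_real h * x) + 1) / (exp (of_real h * x) - 1)))) UNIV"
    if h: "h > 0" and x: "exp (of_real h * x) \<noteq> 1" for h
  proof -
    have x': "exp (of_real h * (-x)) \<noteq> 1" using x by (simp add: exp_minus)
    have "of_real h * (1 / (exp (of_real h * x) - 1) - 1 / (exp (of_real h * (-x)) - 1)) =
       of_real h * ((exp (of_real h * x) + 1) / (exp (of_real h * x) - 1))"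
      using x by (simp add: exp_minus divide_simps) (simp add: algebra_simps)
    moreover have *: "1 / (x - u) - 1 / (- x - u) = 1 / (x - u) + 1 / (x + u)" for u
    proof -
      have "- x - u = - (x + u)" by simp
      thus ?thesis by (simp only: divide_minus_right) simp
    qed
    ultimately show ?thesis
      using has_sum_exp_partial_fractions[OF h x x', unfolded *] by simp
  qed
  have all: "(f has_sum (of_real h * ((E * E + 1) / (E * E - 1)))) UNIV"
    using symm[OF h x] by (simp add: f_def E d_def)
  have E1: "E \<noteq> 1" "E * E \<noteq> 1" "E + 1 \<noteq> 0" 
    using x by (auto simp: E) (metis add_eq_0_iff mult_minus1 minus_minus)
  have "((\<lambda>m. f (2 * m)) has_sum (of_real (h / 2) * ((E + 1) / (E - 1)))) UNIV"
    using symm[of "h / 2"] h E1 by (simp add: f_def E_def d_def mult_ac)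
  hence "((f \<circ> (\<lambda>m. 2 * m)) has_sum (of_real (h / 2) * ((E + 1) / (E - 1)))) UNIV"
    by (simp add: o_def)
  hence "(f has_sum (of_real (h / 2) * ((E + 1) / (E - 1)))) (range (\<lambda>m. 2 * m))"
    by (subst has_sum_reindex) (auto simp: inj_on_def)
  also have "?this \<longleftrightarrow> ((\<lambda>m. if even m then f m else 0) has_sum (of_real (h / 2) * ((E + 1) / (E - 1)))) UNIV"
    by (intro has_sum_cong_neutral) auto
  finally have ev: "((\<lambda>m. if even m then f m else 0) has_sum (of_real (h / 2) * ((E + 1) / (E - 1)))) UNIV" .
  have "((\<lambda>m. 2 * (if even m then f m else 0) - f m) has_sum 
     (2 * (of_real (h / 2) * ((E + 1) / (E - 1))) - of_real h * ((E * E + 1) / (E * E - 1)))) UNIV"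
    using has_sum_add[OF has_sum_cmult_right[OF ev, of 2] has_sum_uminusI[OF all]] by simp
  also have "(\<lambda>m. 2 * (if even m then f m else 0) - f m) = (\<lambda>m. (-1) powi m * f m)"
    by (auto simp: power_int_minus_left)
  also have "2 * (of_real (h / 2) * ((E + 1) / (E - 1))) - of_real h * ((E * E + 1) / (E * E - 1)) = 
     2 * of_real h * E / (E * E - 1)"
  proof -
    have "(E + 1) / (E - 1) = (E + 1) * (E + 1) / (E * E - 1)"
      using E1 by (simp add: divide_simps) (simp add: algebra_simps)
    note quot = this
    have half: "2 * (of_real (h / 2) * w) = of_real h * w" for w :: complex by simp
    have "2 * (of_real (h / 2) * ((E + 1) / (E - 1))) - of_real h * ((E * E + 1) / (E * E - 1)) =
        of_real h * ((E + 1) * (E + 1) - (E * E + 1)) / (E * E - 1)"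
      unfolding half quot by (simp add: right_diff_distrib diff_divide_distrib)
    also have "(E + 1) * (E + 1) - (E * E + 1) = 2 * E" by (simp add: algebra_simps)
    finally show ?thesis by simp
  qed
  finally show ?thesis by (simp add: f_def E E_def)
qed

section \<open>Interchange of summation for negative real part\<close>

text \<open>The common total is left unnamed: in the applications neither iterated sum has a value
  known in advance, and only their equality matters.\<close>

lemma has_sum_interchange:
  fixes f :: "'a \<Rightarrow> 'b \<Rightarrow> 'c::banach"
  assumes "(\<lambda>(x, y). f x y) summable_on A \<times> B"
    and "\<And>x. x \<in> A \<Longrightarrow> (f x has_sum g x) B" and "\<And>y. y \<in> B \<Longrightarrow> ((\<lambda>x. f x y) has_sum k y) A"
  obtains S where "(g has_sum S) A" "(k has_sum S) B"
proof -
  obtain S where S: "((\<lambda>(x, y). f x y) has_sum S) (A \<times> B)"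
    using assms(1) by (auto simp: summable_on_def)
  have "(g has_sum S) A"
    using has_sum_SigmaD[OF S, where g = g] assms(2) by simp
  moreover have "((\<lambda>(y, x). f x y) has_sum S) (B \<times> A)"
    using S by (subst (asm) has_sum_swap) simp
  hence "(k has_sum S) B"
    using has_sum_SigmaD[where f = "\<lambda>(y, x). f x y" and S = S and A = B and B = "\<lambda>_. A" and g = k] assms(3) by simp
  ultimately show ?thesis by (rule that)
qed

lemma summable_on_mult_Times:
  fixes f :: "'a \<Rightarrow> real" and g :: "'b \<Rightarrow> real"
  assumes "f summable_on A" "g summable_on B" "\<And>x. f x \<ge> 0" "\<And>x. g x \<ge> 0"
  shows "(\<lambda>(x, y). f x * g y) summable_on A \<times> B"
proof (rule summable_on_SigmaI)
  fix x
  show "((\<lambda>y. case (x, y) of (x, y) \<Rightarrow> f x * g y) has_sum f x * infsum g B) B"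
    using assms(2) by (simp add: has_sum_cmult_right)
  show "(\<lambda>x. f x * infsum g B) summable_on A"
    using assms(1) by (rule summable_on_cmult_left)
qed (use assms in auto)

lemma summable_on_int:
  fixes f :: "int \<Rightarrow> real"
  assumes "(\<lambda>n. f (int n)) summable_on UNIV" "(\<lambda>n. f (- int n)) summable_on UNIV"
  shows "f summable_on UNIV"
proof -
  have "f summable_on range int" "f summable_on range (\<lambda>n. - int n)"
    using assms by (subst summable_on_reindex; simp add: o_def inj_on_def)+
  hence "f summable_on range int \<union> range (\<lambda>n. - int n)"
    by (rule summable_on_union)
  moreover have "m \<in> range int \<union> range (\<lambda>n. - int n)" for m
    by (cases m rule: int_cases2) auto
  hence "range int \<union> range (\<lambda>n. - int n) = UNIV" by blast
  ultimately show ?thesis by simp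
qed

lemma summable_on_Suc_powr:
  fixes e :: real
  assumes "e < -1"
  shows "(\<lambda>n. real (Suc n) powr e) summable_on UNIV"
proof -
  have "summable (\<lambda>n. real n powr e)"
    using assms by (simp add: summable_real_powr_iff)
  hence "summable (\<lambda>n. real (Suc n) powr e)"
    by (subst summable_Suc_iff)
  thus ?thesis by (rule summable_nonneg_imp_summable_on) auto
qed

lemma summable_on_nat_int_powr:
  fixes e :: real
  assumes "e < -1"
  shows "(\<lambda>(n, m). real (Suc n) powr e * (1 + of_int \<bar>m\<bar>) powr e) summable_on (UNIV \<times> (UNIV :: int set))"
proof (rule summable_on_mult_Times)
  have "(\<lambda>n. (1 + real n) powr e) summable_on UNIV"
    using summable_on_Suc_powr[OF assms] by simp
  thus "(\<lambda>m::int. (1 + of_int \<bar>m\<bar> :: real) powr e) summable_on UNIV"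
    by (intro summable_on_int) simp_all
qed (use summable_on_Suc_powr[OF assms] in auto)

text \<open>Away from a finite set the real and imaginary parts grow with \<open>k\<close> and
  \<open>m\<close> and outweigh the shift \<open>x\<close>. On the finite set the quotients are
  positive and have a positive minimum.\<close>

lemma norm_lattice_shift_ge:
  fixes x :: complex and t :: real
  assumes t: "t > 0" and nz: "\<And>k m. of_nat k + x - \<i> * of_real t * of_int m \<noteq> 0"
  obtains c where "c > 0" "\<And>k m. norm (of_nat k + x - \<i> * of_real t * of_int m) \<ge> c * (real (Suc k) + of_int \<bar>m\<bar>)"
proof -
  define f where "f = (\<lambda>(k, m). norm (of_nat k + x - \<i> * of_real t * of_int m))"
  define g where "g = (\<lambda>(k, m). real (Suc k) + of_int \<bar>m\<bar>)"
  have g_pos: "g p > 0" for p by (auto simp: g_def case_prod_unfold)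
  have f_pos: "f p > 0" for p using nz by (auto simp: f_def case_prod_unfold)
  define u where "u = min 1 t"
  have u: "u > 0" "u \<le> 1" "u \<le> t" using t by (auto simp: u_def)
  \<comment> \<open>With g = k + 1 + |m|, twice the modulus is at least u * (g - 1) - 2 * norm x.
    For g >= N this is at least u * g / 2, whence the constant u / 4.\<close>
  define N where "N = 2 + 4 * norm x / u"
  define F where "F = {p. g p < N}"
  have "F \<subseteq> {..nat \<lceil>N\<rceil>} \<times> {-\<lceil>N\<rceil>..\<lceil>N\<rceil>}"
  proof
    fix p assume "p \<in> F"
    then obtain k m where p: "p = (k, m)" "real (Suc k) + of_int \<bar>m\<bar> < N" 
      by (cases p) (auto simp: F_def g_def)
    have "of_int \<bar>m\<bar> \<le> N" "real k \<le> N" using p by auto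
    hence "of_int \<bar>m\<bar> \<le> (of_int \<lceil>N\<rceil> :: real)" "of_int (int k) \<le> (of_int \<lceil>N\<rceil> :: real)"
      using le_of_int_ceiling[of N] by (auto simp del: le_of_int_ceiling intro: order.trans)
    hence "\<bar>m\<bar> \<le> \<lceil>N\<rceil>" "int k \<le> \<lceil>N\<rceil>" unfolding of_int_le_iff .
    thus "p \<in> {..nat \<lceil>N\<rceil>} \<times> {-\<lceil>N\<rceil>..\<lceil>N\<rceil>}" using p(1) by auto
  qed
  hence fin: "finite F" by (rule finite_subset) auto
  define c where "c = Min (insert (u / 4) ((\<lambda>p. f p / g p) ` F))"
  have "c > 0"
    unfolding c_def using fin u f_pos g_pos by (subst Min_gr_iff) (auto simp del: split_paired_All)
  moreover have "f p \<ge> c * g p" for p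
  proof (cases "p \<in> F")
    case True
    hence "c \<le> f p / g p" unfolding c_def using fin by (intro Min_le) auto
    thus ?thesis using g_pos[of p] by (simp add: pos_le_divide_eq)
  next
    case False
    obtain k m where p: "p = (k, m)" by (cases p)
    have g: "g p = real k + 1 + \<bar>of_int m\<bar>" by (simp add: p g_def)
    define w where "w = of_nat k + x - \<i> * of_real t * of_int m"
    have "real k - norm x \<le> Re w" 
      using complex_Re_le_cmod[of "-x"] by (simp add: w_def)
    moreover have "\<bar>Re w\<bar> \<le> norm w" "\<bar>Im w\<bar> \<le> norm w" by (rule abs_Re_le_cmod abs_Im_le_cmod)+
    moreover have "t * \<bar>of_int m\<bar> - norm x \<le> \<bar>Im w\<bar>" 
    proof -
      have "Im w = Im x - t * of_int m" by (simp add: w_def)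
      moreover have "\<bar>t * of_int m\<bar> = t * \<bar>of_int m\<bar>" using t by (simp add: abs_mult)
      ultimately show ?thesis using abs_Im_le_cmod[of x] by linarith
    qed
    ultimately have "2 * norm w \<ge> real k + t * \<bar>of_int m\<bar> - 2 * norm x" by linarith
    moreover have "u * real k \<le> real k" "u * \<bar>of_int m\<bar> \<le> t * \<bar>of_int m\<bar>"
      using u by (auto intro: mult_left_le_one_le mult_right_mono)
    moreover have "u * g p = u * real k + u + u * \<bar>of_int m\<bar>" by (simp add: g algebra_simps)
    moreover have "u * g p \<ge> u * N" using False u by (intro mult_left_mono) (auto simp: F_def)
    moreover have "u * N = 2 * u + 4 * norm x" using u by (simp add: N_def field_simps)
    ultimately have "u / 4 * g p \<le> norm w" by linarith
    moreover have "c * g p \<le> u / 4 * g p"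
      using g_pos[of p] fin unfolding c_def by (intro mult_right_mono Min_le) auto
    ultimately show ?thesis by (simp add: f_def p w_def)
  qed
  hence "\<And>k m. c * g (k, m) \<le> f (k, m)" by blast
  ultimately show ?thesis using that[of c] by (simp add: f_def g_def)
qed

text \<open>For x, y >= 1 the number x - 1 + y dominates both, hence every weighted geometric mean
  of them. The exponent \<open>d\<close> decides how the decay is shared.\<close>

lemma inverse_add_le_powr:
  fixes x y d :: real
  assumes "x \<ge> 1" "y \<ge> 1" "0 \<le> d" "d \<le> 1"
  shows "1 / (x - 1 + y) \<le> x powr (d - 1) * y powr (- d)"
proof -
  have "x powr (1 - d) * y powr d \<le> (x - 1 + y) powr (1 - d) * (x - 1 + y) powr d"
    using assms by (intro mult_mono powr_mono2) auto
  also have "\<dots> = x - 1 + y" using assms by (simp flip: powr_add)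
  finally have "1 / (x - 1 + y) \<le> 1 / (x powr (1 - d) * y powr d)"
    using assms by (intro divide_left_mono) auto
  also have "\<dots> = x powr (d - 1) * y powr (- d)"
    using assms by (simp add: powr_minus powr_diff field_simps)
  finally show ?thesis .
qed

lemma has_sum_if_sums_summable_on:
  fixes f :: "nat \<Rightarrow> 'a::{topological_comm_monoid_add,t2_space}"
  assumes "f sums S" "f summable_on UNIV"
  shows "(f has_sum S) UNIV"
  using assms by (metis has_sum_imp_sums has_sum_infsum sums_unique2)

text \<open>
  In the application \<open>h = 4 ln \<epsilon>\<close>, so that \<open>node m\<close> is the Gamma argument
  \<open>s / 2 - \<pi> \<i> m / (2 ln \<epsilon>)\<close>.
\<close>

locale exp_lattice =
  fixes h :: real and s :: complex
  assumes h_pos: "h > 0"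
    and exp_neq: "\<And>k. exp (of_real h * (s / 2 + of_nat k)) \<noteq> 1"
begin

definition step :: complex where "step = 2 * of_real pi * \<i> / of_real h"

definition node :: "int \<Rightarrow> complex" where "node m = s / 2 - step * of_int m"

lemma node_nonzero: "of_nat k + node m \<noteq> 0"
proof
  assume "of_nat k + node m = 0"
  hence "s / 2 + of_nat k = step * of_int m" by (simp add: node_def algebra_simps)
  moreover have "of_real h * (step * of_int m) = 2 * of_int m * of_real pi * \<i>" 
    using h_pos by (simp add: step_def)
  ultimately have "exp (of_real h * (s / 2 + of_nat k)) = exp (2 * of_int m * of_real pi * \<i>)" by (simp only:)
  also have "\<dots> = 1" by (subst exp_eq_1) (auto intro!: exI[of _ m])
  finally show False using exp_neq by blast
qed

lemma node_notin_nonpos_Ints: "node m \<notin> \<int>\<^sub>\<le>\<^sub>0"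
proof
  assume "node m \<in> \<int>\<^sub>\<le>\<^sub>0"
  then obtain n where "node m = - of_nat n" by (auto elim!: nonpos_Ints_cases')
  thus False using node_nonzero[of n m] by simp
qed

lemma diff_node: "s - node m = node (- m)"
  by (simp add: node_def)

lemma norm_node_ge:
  obtains c where "c > 0" "\<And>k m. norm (of_nat k + node m) \<ge> c * (real (Suc k) + of_int \<bar>m\<bar>)"
proof -
  have eq: "of_nat k + node m = of_nat k + s / 2 - \<i> * of_real (2 * pi / h) * of_int m" for k m
    by (simp add: node_def step_def field_simps)
  show ?thesis
    by (rule norm_lattice_shift_ge[of "2 * pi / h" "s / 2"])
       (use h_pos node_nonzero that in \<open>simp_all add: eq\<close>)
qed

text \<open>The constant does not depend on \<open>d\<close>: the double sums apply the bound to one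
  factor with a small \<open>d\<close> and to another with d = 1.\<close>

lemma inverse_norm_node_le:
  obtains C where "C > 0" 
    "\<And>k m d. 0 \<le> d \<Longrightarrow> d \<le> 1 \<Longrightarrow> 1 / norm (of_nat k + node m) \<le> C * (real (Suc k) powr (d - 1) * (1 + of_int \<bar>m\<bar>) powr (- d))"
proof -
  obtain c where c: "c > 0" "\<And>k m. norm (of_nat k + node m) \<ge> c * (real (Suc k) + of_int \<bar>m\<bar>)"
    using norm_node_ge by blast
  have "1 / norm (of_nat k + node m) \<le> 1 / c * (real (Suc k) powr (d - 1) * (1 + of_int \<bar>m\<bar>) powr (- d))"
    if d: "0 \<le> d" "d \<le> 1" for k m d
  proof -
    have "1 / norm (of_nat k + node m) \<le> 1 / (c * (real (Suc k) + of_int \<bar>m\<bar>))"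
      using c(2)[of k m] c(1) node_nonzero[of k m] by (intro divide_left_mono mult_pos_pos) auto
    also have "\<dots> = 1 / c * (1 / (real (Suc k) - 1 + (1 + of_int \<bar>m\<bar>)))" by simp
    also have "\<dots> \<le> 1 / c * (real (Suc k) powr (d - 1) * (1 + of_int \<bar>m\<bar>) powr (- d))"
      using c(1) d by (intro mult_left_mono inverse_add_le_powr) auto
    finally show ?thesis .
  qed
  thus ?thesis using c(1) by (intro that[of "1 / c"]) auto
qed

text \<open>
  Subtracting \<open>1 / node m\<close> makes the double sum absolutely convergent; it costs nothing after
  summation over \<open>k\<close>, since the binomial coefficients sum to \<open>(1 - 1) powr (- s) = 0\<close>.
\<close>

lemma even_double_sum:
  assumes s: "Re s < 0"
  obtains S where
    "((\<lambda>m. Gamma (1 - s) * (Gamma (node m) * rGamma (node m + 1 - s))) has_sum of_real h * S) UNIV"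
    "((\<lambda>k. pochhammer s k / fact k / (exp (of_real h * (s / 2 + of_nat k)) - 1)) has_sum S) UNIV"
proof -
  define u where "u = (\<lambda>k m. pochhammer s k / fact k * (1 / (of_nat k + node m) - 1 / node m))"
  \<comment> \<open>Small enough that the coefficient is O(k powr (-2 d - 1)). With one factor
    \<open>k\<close> and k powr (d - 1) from a node this leaves k powr (-1 - d), and the two nodes
    give |m| powr (-d) and |m| powr (-1).\<close>
  define d where "d = min (- Re s) 1 / 2"
  have d: "0 < d" "2 * d \<le> - Re s" "d \<le> 1" using s by (auto simp: d_def)
  obtain C where C: "C > 0" "\<And>k. norm (pochhammer s k / fact k) \<le> C * real (Suc k) powr (Re s - 1)"
    using norm_pochhammer_over_fact_le'[of s] s by auto
  obtain D where D: "D > 0" 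
    "\<And>k m d. 0 \<le> d \<Longrightarrow> d \<le> 1 \<Longrightarrow> 1 / norm (of_nat k + node m) \<le> D * (real (Suc k) powr (d - 1) * (1 + of_int \<bar>m\<bar>) powr (- d))"
    using inverse_norm_node_le by blast
  have u_bnd: "norm (u k m) \<le> C * D * D * (real (Suc k) powr (- 1 - d) * (1 + of_int \<bar>m\<bar>) powr (- 1 - d))" for k m
  proof -
    define M where "M = (1 + of_int \<bar>m\<bar> :: real)"
    have M: "M \<ge> 1" by (simp add: M_def)
    have nz: "of_nat k + node m \<noteq> 0" "node m \<noteq> 0" using node_nonzero[of k m] node_nonzero[of 0 m] by auto
    \<comment> \<open>Writing \<open>node m\<close> with a summand 0 makes it an instance of the
      same node bound at k = 0.\<close>
    have "u k m = pochhammer s k / fact k * (- of_nat k) * (1 / (of_nat k + node m)) * (1 / (of_nat 0 + node m))"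
      using nz by (simp add: u_def divide_simps) 
    hence "norm (u k m) = norm (pochhammer s k / fact k) * real k * (1 / norm (of_nat k + node m)) * (1 / norm (of_nat 0 + node m))"
      by (simp only: norm_mult norm_minus_cancel norm_of_nat norm_divide norm_one)
    also have "\<dots> \<le> (C * real (Suc k) powr (- 2 * d - 1)) * real (Suc k) * (D * (real (Suc k) powr (d - 1) * M powr (- d))) *
       (D * (real (Suc 0) powr (1 - 1) * M powr (- 1)))"
    proof (intro mult_mono)
      show "norm (pochhammer s k / fact k) \<le> C * real (Suc k) powr (- 2 * d - 1)"
        using C d by (intro order.trans[OF C(2)] mult_left_mono powr_mono) auto
    qed (use C(1) D d M in \<open>auto simp only: M_def zero_le_mult_iff of_nat_0_le_iff powr_ge_zero zero_le_divide_iff norm_ge_zero order.refl of_nat_le_iff le_SucI less_imp_le zero_le_one\<close>)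
    also have "\<dots> = C * D * D * ((real (Suc k) powr (- 2 * d - 1) * real (Suc k) powr 1 * real (Suc k) powr (d - 1)) * (M powr (- d) * M powr (- 1)))"
      by (simp add: mult_ac)
    also have "\<dots> = C * D * D * (real (Suc k) powr (- 1 - d) * M powr (- 1 - d))"
    proof -
      have "- 2 * d - 1 + 1 + (d - 1) = - 1 - d" "- d + - 1 = - 1 - d" by auto
      thus ?thesis unfolding powr_add[symmetric] by (simp only:)
    qed
    finally show ?thesis by (simp only: M_def)
  qed
  have summ: "(\<lambda>(k, m). u k m) summable_on UNIV \<times> UNIV"
  proof (rule abs_summable_summable, rule Infinite_Sum.abs_summable_on_comparison_test')
    show "(\<lambda>p. C * D * D * (case p of (k, m) \<Rightarrow> real (Suc k) powr (- 1 - d) * (1 + of_int \<bar>m::int\<bar>) powr (- 1 - d))) summable_on UNIV \<times> UNIV"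
      using d by (intro summable_on_cmult_right summable_on_nat_int_powr) auto
  qed (use u_bnd in auto)
  define A where "A = (\<lambda>k. pochhammer s k / fact k * (of_real h * (1 / (exp (of_real h * (s / 2 + of_nat k)) - 1) - 1 / (exp (of_real h * (s / 2)) - 1))))"
  define B where "B = (\<lambda>m. Gamma (1 - s) * (Gamma (node m) * rGamma (node m + 1 - s)))"
  have rows: "(u k has_sum A k) UNIV" for k
    unfolding u_def A_def
  proof (rule has_sum_cmult_right)
    have "exp (of_real h * (s / 2)) \<noteq> 1" using exp_neq[of 0] by simp
    from has_sum_exp_partial_fractions[OF h_pos exp_neq[of k] this]
    show "((\<lambda>m. 1 / (of_nat k + node m) - 1 / node m) has_sum
       of_real h * (1 / (exp (of_real h * (s / 2 + of_nat k)) - 1) - 1 / (exp (of_real h * (s / 2)) - 1))) UNIV"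
      by (simp add: node_def step_def add_ac add_diff_eq)
  qed
  have cols: "((\<lambda>k. u k m) has_sum B m) UNIV" for m
  proof (rule has_sum_if_sums_summable_on)
    have "(\<lambda>k. pochhammer s k / fact k / (node m + of_nat k) - pochhammer s k / fact k * (1 / node m)) sums (B m - 0 * (1 / node m))"
      unfolding B_def by (intro sums_diff sums_mult2 Gamma_quotient_sums node_notin_nonpos_Ints pochhammer_over_fact_sums_0 s)
    thus "(\<lambda>k. u k m) sums B m"
      by (simp add: u_def algebra_simps)
    have "(\<lambda>(m, k). u k m) summable_on UNIV \<times> UNIV"
      using summ by (subst summable_on_swap) simp
    thus "(\<lambda>k. u k m) summable_on UNIV"
      by (rule summable_on_SigmaD1) auto
  qed
  obtain S where S: "(A has_sum S) UNIV" "(B has_sum S) UNIV"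
    using has_sum_interchange[OF summ rows cols] by blast
  \<comment> \<open>The vanishing sum is used a second time: each \<open>A k\<close> contains the
    constant 1 / (exp (h s / 2) - 1) with the binomial coefficient as weight, so restoring it
    changes nothing.\<close>
  have z: "((\<lambda>k. pochhammer s k / fact k) has_sum 0) UNIV"
    by (intro norm_summable_imp_has_sum abs_summable_pochhammer_over_fact pochhammer_over_fact_sums_0 s)
  have "((\<lambda>k. 1 / of_real h * A k + pochhammer s k / fact k * (1 / (exp (of_real h * (s / 2)) - 1))) has_sum 
     (1 / of_real h * S + 0 * (1 / (exp (of_real h * (s / 2)) - 1)))) UNIV"
    by (intro has_sum_add has_sum_cmult_right has_sum_cmult_left S z)
  also have "(\<lambda>k. 1 / of_real h * A k + pochhammer s k / fact k * (1 / (exp (of_real h * (s / 2)) - 1))) =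
    (\<lambda>k. pochhammer s k / fact k / (exp (of_real h * (s / 2 + of_nat k)) - 1))"
    using h_pos by (intro ext) (simp add: A_def right_diff_distrib)
  finally show ?thesis
    using S(2) h_pos by (intro that[of "S / of_real h"]) (simp_all add: B_def)
qed

text \<open>
  Here it is the pairing of \<open>node m\<close> with \<open>node (- m)\<close> that yields absolute convergence.
\<close>

lemma odd_double_sum:
  assumes s: "-1 < Re s" "Re s < 0"
  obtains S where
    "((\<lambda>m. (-1) powi m * (Gamma (node m) * Gamma (node (- m)) * rGamma s)) has_sum 2 * of_real h * S) UNIV"
    "((\<lambda>k. (-1) ^ k * (pochhammer s k / fact k) * exp (of_real h * (s / 2 + of_nat k) / 2) / 
        (exp (of_real h * (s / 2 + of_nat k)) - 1)) has_sum S) UNIV"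
proof -
  define u where "u = (\<lambda>k m. (-1) powi m * ((-1) ^ k * (pochhammer s k / fact k) * (1 / (node m + of_nat k) + 1 / (node (- m) + of_nat k))))"
  define d where "d = - Re s / 2"
  have d: "0 < d" "2 * d = - Re s" "d \<le> 1" using s by (auto simp: d_def)
  obtain C where C: "C > 0" "\<And>k. norm (pochhammer s k / fact k) \<le> C * real (Suc k) powr (Re s - 1)"
    using norm_pochhammer_over_fact_le'[of s] s by auto
  obtain D where D: "D > 0" 
    "\<And>k m d. 0 \<le> d \<Longrightarrow> d \<le> 1 \<Longrightarrow> 1 / norm (of_nat k + node m) \<le> D * (real (Suc k) powr (d - 1) * (1 + of_int \<bar>m\<bar>) powr (- d))"
    using inverse_norm_node_le by blast
  define E where "E = norm s + 2"
  have E: "E > 0" by (simp add: E_def add_nonneg_pos)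
  have u_bnd: "norm (u k m) \<le> C * E * D * D * (real (Suc k) powr (- 1 - d) * (1 + of_int \<bar>m\<bar>) powr (- 1 - d))" for k m
  proof -
    define M where "M = (1 + of_int \<bar>m\<bar> :: real)"
    have M: "M \<ge> 1" by (simp add: M_def)
    have nz: "of_nat k + node m \<noteq> 0" "of_nat k + node (- m) \<noteq> 0" using node_nonzero by auto
    have *: "node m + node (- m) = s" using diff_node[of m] by (simp add: algebra_simps)
    \<comment> \<open>The two nodes add up to \<open>s\<close>, so the numerator s + 2 k is free of
      \<open>m\<close> and the pair decays quadratically in \<open>m\<close>. The exponents are then
      balanced as in the even case, with \<open>E\<close> absorbing the size of the
      numerator.\<close>
    have "1 / (node m + of_nat k) + 1 / (node (- m) + of_nat k) = 
       (node m + node (- m) + 2 * of_nat k) * (1 / (of_nat k + node m)) * (1 / (of_nat k + node (- m)))"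
      using nz by (simp add: divide_simps add_ac)
    hence "norm (u k m) = norm (pochhammer s k / fact k) * norm (s + 2 * of_nat k) * (1 / norm (of_nat k + node m)) * (1 / norm (of_nat k + node (- m)))"
      unfolding u_def * by (simp add: norm_mult norm_divide norm_power norm_power_int)
    also have "\<dots> \<le> (C * real (Suc k) powr (- 2 * d - 1)) * (E * real (Suc k)) * (D * (real (Suc k) powr (d - 1) * M powr (- d))) *
       (D * (real (Suc k) powr (1 - 1) * M powr (- 1)))"
    proof (intro mult_mono)
      show "norm (pochhammer s k / fact k) \<le> C * real (Suc k) powr (- 2 * d - 1)"
        using C d by (intro order.trans[OF C(2)] mult_left_mono powr_mono) auto
      have "norm (s + 2 * of_nat k) \<le> norm s + 2 * real k"
        by (rule order.trans[OF norm_triangle_ineq]) (simp add: norm_mult)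
      also have "\<dots> \<le> E * real (Suc k)"
        by (simp add: E_def algebra_simps)
      finally show "norm (s + 2 * of_nat k) \<le> E * real (Suc k)" .
      show "1 / norm (of_nat k + node (- m)) \<le> D * (real (Suc k) powr (1 - 1) * M powr (- 1))"
        using D(2)[of 1 k "- m"] by (simp add: M_def)
    qed (use C(1) D E d M in \<open>auto simp only: M_def zero_le_mult_iff of_nat_0_le_iff powr_ge_zero zero_le_divide_iff norm_ge_zero order.refl of_nat_le_iff le_SucI less_imp_le zero_le_one\<close>)
    also have "\<dots> = C * E * D * D * ((real (Suc k) powr (- 2 * d - 1) * real (Suc k) powr 1 * real (Suc k) powr (d - 1)) * (M powr (- d) * M powr (- 1)))"
      by (simp add: mult_ac)
    also have "\<dots> = C * E * D * D * (real (Suc k) powr (- 1 - d) * M powr (- 1 - d))"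
    proof -
      have "- 2 * d - 1 + 1 + (d - 1) = - 1 - d" "- d + - 1 = - 1 - d" by auto
      thus ?thesis unfolding powr_add[symmetric] by (simp only:)
    qed
    finally show ?thesis by (simp only: M_def)
  qed
  have summ: "(\<lambda>(k, m). u k m) summable_on UNIV \<times> UNIV"
  proof (rule abs_summable_summable, rule Infinite_Sum.abs_summable_on_comparison_test')
    show "(\<lambda>p. C * E * D * D * (case p of (k, m) \<Rightarrow> real (Suc k) powr (- 1 - d) * (1 + of_int \<bar>m::int\<bar>) powr (- 1 - d))) summable_on UNIV \<times> UNIV"
      using d by (intro summable_on_cmult_right summable_on_nat_int_powr) auto
  qed (use u_bnd in auto)
  define A where "A = (\<lambda>k. (-1) ^ k * (pochhammer s k / fact k) * (2 * of_real h * exp (of_real h * (s / 2 + of_nat k) / 2) / (exp (of_real h * (s / 2 + of_nat k)) - 1)))"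
  define B where "B = (\<lambda>m. (-1) powi m * (Gamma (node m) * Gamma (node (- m)) * rGamma s))"
  have rows: "(u k has_sum A k) UNIV" for k
  proof -
    have "((\<lambda>m. (-1) ^ k * (pochhammer s k / fact k) * ((-1) powi m * (1 / (node m + of_nat k) + 1 / (node (- m) + of_nat k)))) has_sum A k) UNIV"
      unfolding A_def
      using has_sum_csch_partial_fractions[OF h_pos exp_neq[of k]]
      by (intro has_sum_cmult_right) (simp add: node_def step_def add_ac add_diff_eq diff_add_eq)
    thus ?thesis by (simp add: u_def mult_ac)
  qed
  have cols: "((\<lambda>k. u k m) has_sum B m) UNIV" for m
  proof (rule has_sum_if_sums_summable_on)
    show "(\<lambda>k. u k m) sums B m"
      unfolding B_def u_def
      using Gamma_mult_sums[OF s node_notin_nonpos_Ints[of m]] node_notin_nonpos_Ints[of "-m"]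
      by (intro sums_mult) (simp add: diff_node)
    have "(\<lambda>(m, k). u k m) summable_on UNIV \<times> UNIV"
      using summ by (subst summable_on_swap) simp
    thus "(\<lambda>k. u k m) summable_on UNIV"
      by (rule summable_on_SigmaD1) auto
  qed
  obtain S where S: "(A has_sum S) UNIV" "(B has_sum S) UNIV"
    using has_sum_interchange[OF summ rows cols] by blast
  have "((\<lambda>k. 1 / (2 * of_real h) * A k) has_sum (1 / (2 * of_real h) * S)) UNIV"
    by (intro has_sum_cmult_right S)
  also have "(\<lambda>k. 1 / (2 * of_real h) * A k) = (\<lambda>k. (-1) ^ k * (pochhammer s k / fact k) * exp (of_real h * (s / 2 + of_nat k) / 2) / 
        (exp (of_real h * (s / 2 + of_nat k)) - 1))"
    using h_pos by (intro ext) (simp add: A_def)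
  finally show ?thesis
    using S(2) h_pos by (intro that[of "S / (2 * of_real h)"]) (simp_all add: B_def)
qed

end

section \<open>Meromorphic continuation\<close>

lemma norm_pochhammer_le:
  fixes z :: complex
  assumes "norm z \<le> R"
  shows "norm (pochhammer z k) \<le> pochhammer R k"
  unfolding pochhammer_prod prod_norm[symmetric]
proof (intro prod_mono conjI)
  fix i
  show "norm (z + of_nat i) \<le> R + of_nat i"
    using norm_triangle_ineq[of z "of_nat i"] assms by simp
qed auto

lemma pochhammer_powser_sums:
  fixes z x :: complex
  assumes "norm x < 1"
  shows "(\<lambda>k. pochhammer z k / fact k * x ^ k) sums (1 - x) powr (- z)"
proof -
  have "(-z gchoose k) * (-x) ^ k = pochhammer z k / fact k * x ^ k" for k
    by (simp add: gbinomial_pochhammer power_minus[of x])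
  thus ?thesis
    using gen_binomial_complex[of "-x" "-z"] assms by simp
qed

lemma summable_pochhammer_powser:
  fixes R r :: real
  assumes "0 \<le> r" "r < 1"
  shows "summable (\<lambda>k. pochhammer R k / fact k * r ^ k)"
proof -
  have "(-R gchoose k) * (-r) ^ k = pochhammer R k / fact k * r ^ k" for k
    by (simp add: gbinomial_pochhammer power_minus[of r])
  thus ?thesis
    using gen_binomial_real[of "-r" "-R"] assms by (simp add: sums_iff)
qed

text \<open>
  The odd series is the case \<open>p = 1 / 2\<close>, \<open>e = -1\<close>, the even one the case \<open>p = 0\<close>, \<open>e = 1\<close>.
\<close>

locale sinh_series =
  fixes h p :: real and e :: complex
  assumes h_pos: "h > 0" and p: "0 \<le> p" "p \<le> 1 / 2" and norm_e: "norm e = 1"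
begin

text \<open>With X = s / 2 + k, the exponential quotient is the geometric series over n >= 1 of exp
  (-h * (n - p) * X), continued beyond Re X > 0.\<close>

definition term_at :: "nat \<Rightarrow> complex \<Rightarrow> complex" where
  "term_at k s = e ^ k * (pochhammer s k / fact k) * exp (of_real (p * h) * (s / 2 + of_nat k)) /
     (exp (of_real h * (s / 2 + of_nat k)) - 1)"

text \<open>Equivalently, no s / 2 - 2 pi i m / h is a nonpositive integer, so the same set avoids
  the poles of the Gamma factors. It depends on \<open>h\<close> only and is common to the odd and
  the even series.\<close>

definition regular :: "complex set" where
  "regular = {s. \<forall>k. exp (of_real h * (s / 2 + of_nat k)) \<noteq> 1}"

lemma norm_exp_ge_2:
  obtains K :: nat where "\<And>k (s :: complex). k \<ge> K \<Longrightarrow> norm s < R \<Longrightarrow> norm (exp (of_real h * (s / 2 + of_nat k))) \<ge> 2"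
proof -
  \<comment> \<open>Then Re s / 2 + k >= 1 / h, and exp y >= 1 + y gives the bound 2.\<close>
  define K where "K = nat \<lceil>R / 2 + 1 / h\<rceil>"
  have "norm (exp (of_real h * (s / 2 + of_nat k))) \<ge> 2" if "k \<ge> K" "norm s < R" for k and s :: complex
  proof -
    have "real k \<ge> R / 2 + 1 / h"
      using that(1) unfolding K_def by linarith
    moreover have "- Re s \<le> norm s" using complex_Re_le_cmod[of "-s"] by simp
    ultimately have "Re s / 2 + real k \<ge> 1 / h" using that(2) by linarith
    hence "h * (Re s / 2 + real k) \<ge> 1" using h_pos by (simp add: field_simps)
    moreover have "exp (h * (Re s / 2 + real k)) \<ge> 1 + h * (Re s / 2 + real k)" by (rule exp_ge_add_one_self)
    moreover have "norm (exp (of_real h * (s / 2 + of_nat k))) = exp (h * (Re s / 2 + real k))" by simp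
    ultimately show ?thesis by linarith
  qed
  thus ?thesis using that by blast
qed

text \<open>Once the exponential is at least 2 in modulus, subtracting 1 costs at most half of it.
  What remains is exp (-(1 - p) * h * x), where p <= 1 / 2 and x >= k - R / 2 give the ratio exp (-h
  / 2) and the factor exp (h R / 4).\<close>

lemma norm_term_at_le:
  assumes k: "norm (exp (of_real h * (s / 2 + of_nat k))) \<ge> 2" and s: "norm s \<le> R"
  shows "norm (term_at k s) \<le> 2 * exp (h * R / 4) * (pochhammer R k / fact k * exp (- h / 2) ^ k)"
proof -
  define x where "x = Re s / 2 + real k"
  have R0: "pochhammer R k \<ge> 0" by (rule order.trans[OF norm_ge_zero norm_pochhammer_le[OF s]])
  have n: "norm (exp (of_real h * (s / 2 + of_nat k))) = exp (h * x)" by (simp add: x_def)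
  have "exp (h * x) / 2 \<le> exp (h * x) - norm (1 :: complex)" using k unfolding n by simp
  also have "\<dots> \<le> norm (exp (of_real h * (s / 2 + of_nat k)) - 1)"
    unfolding n[symmetric] by (rule norm_triangle_ineq2)
  finally have den: "exp (h * x) / 2 \<le> norm (exp (of_real h * (s / 2 + of_nat k)) - 1)" .
  have "1 \<le> exp (h * x)" using k unfolding n by linarith
  hence hx: "h * x \<ge> 0" by simp
  have "- Re s \<le> norm s" using complex_Re_le_cmod[of "-s"] by simp
  hence x: "x \<ge> real k - R / 2" using s by (simp add: x_def)
  have "norm (exp (of_real (p * h) * (s / 2 + of_nat k))) = exp (p * h * x)" by (simp add: x_def)
  hence "norm (term_at k s) = norm (pochhammer s k) / fact k * (exp (p * h * x) / norm (exp (of_real h * (s / 2 + of_nat k)) - 1))"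
    unfolding term_at_def norm_mult norm_divide norm_power norm_e norm_fact by simp
  also have "\<dots> \<le> pochhammer R k / fact k * (exp (p * h * x) / (exp (h * x) / 2))"
  proof (rule mult_mono)
    have pos: "0 < exp (h * x) / 2" by simp
    show "exp (p * h * x) / norm (exp (of_real h * (s / 2 + of_nat k)) - 1) \<le> exp (p * h * x) / (exp (h * x) / 2)"
      by (rule divide_left_mono[OF den]) (use order.strict_trans2[OF pos den] pos in \<open>simp_all only: exp_ge_zero mult_pos_pos\<close>)
    show "norm (pochhammer s k) / fact k \<le> pochhammer R k / fact k"
      by (intro divide_right_mono norm_pochhammer_le s) simp
  qed (simp_all add: R0)
  also have "exp (p * h * x) / (exp (h * x) / 2) = 2 * exp (p * h * x - h * x)"
    by (simp add: exp_diff)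
  also have "p * h * x - h * x = - ((1 - p) * (h * x))"
    by (simp add: algebra_simps)
  also have "pochhammer R k / fact k * (2 * exp (- ((1 - p) * (h * x)))) \<le> pochhammer R k / fact k * (2 * exp (- (h / 2 * (real k - R / 2))))"
    using R0
  proof (intro mult_left_mono)
    have "h / 2 * (real k - R / 2) \<le> h / 2 * x" using x h_pos by (intro mult_left_mono) auto
    also have "\<dots> = 1 / 2 * (h * x)" by simp
    also have "\<dots> \<le> (1 - p) * (h * x)" using p hx by (intro mult_right_mono) auto
    finally show "exp (- ((1 - p) * (h * x))) \<le> exp (- (h / 2 * (real k - R / 2)))" by simp
  qed auto
  also have "exp (- (h / 2 * (real k - R / 2))) = exp (h * R / 4) * exp (real k * (- h / 2))"
    by (simp add: mult_exp_exp algebra_simps)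
  also have "exp (real k * (- h / 2)) = exp (- h / 2) ^ k"
    by (rule exp_of_nat_mult)
  finally show ?thesis by (simp add: mult_ac)
qed

section \<open>Holomorphy and meromorphy of the series over k\<close>

lemma analytic_pochhammer: "(\<lambda>s::complex. pochhammer s k) analytic_on A"
  unfolding pochhammer_prod by (intro analytic_intros)

lemma term_at_meromorphic: "term_at k meromorphic_on A"
proof -
  have "(\<lambda>s. e ^ k * (pochhammer s k / fact k) * exp (of_real (p * h) * (s / 2 + of_nat k)) / (exp (of_real h * (s / 2 + of_nat k)) - 1)) meromorphic_on A"
    by (intro meromorphic_on_divide analytic_on_imp_meromorphic_on analytic_intros analytic_pochhammer) auto
  thus ?thesis by (simp add: term_at_def[abs_def])
qed

lemma term_at_analytic: 
  assumes "\<And>s. s \<in> A \<Longrightarrow> exp (of_real h * (s / 2 + of_nat k)) \<noteq> 1"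
  shows "term_at k analytic_on A"
proof -
  have "(\<lambda>s. e ^ k * (pochhammer s k / fact k) * exp (of_real (p * h) * (s / 2 + of_nat k)) / (exp (of_real h * (s / 2 + of_nat k)) - 1)) analytic_on A"
    using assms by (intro analytic_intros analytic_pochhammer) auto
  thus ?thesis by (simp add: term_at_def[abs_def])
qed

text \<open>In a disc only finitely many terms can have poles, and the tail is holomorphic by the
  M-test. The splitting also holds at the poles themselves: division by zero gives 0 there, and
  convergence depends on the tail alone.\<close>

lemma suminf_term_at_split:
  obtains K T where "\<And>k (s :: complex). k \<ge> K \<Longrightarrow> norm s < R \<Longrightarrow> exp (of_real h * (s / 2 + of_nat k)) \<noteq> 1"
    "T analytic_on ball 0 R" "\<And>s. norm s < R \<Longrightarrow> (\<Sum>k. term_at k s) = T s + (\<Sum>k<K. term_at k s)"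
proof -
  obtain K where K: "\<And>k (s :: complex). k \<ge> K \<Longrightarrow> norm s < R \<Longrightarrow> norm (exp (of_real h * (s / 2 + of_nat k))) \<ge> 2"
    using norm_exp_ge_2 by blast
  define M where "M = (\<lambda>k. 2 * exp (h * R / 4) * (pochhammer R k / fact k * exp (- h / 2) ^ k))"
  have M: "norm (term_at k s) \<le> M k" if "k \<ge> K" "norm s < R" for k s
    unfolding M_def using that by (intro norm_term_at_le K) auto
  have sM: "summable M"
    unfolding M_def using h_pos by (intro summable_mult summable_pochhammer_powser) auto
  have neq: "exp (of_real h * (s / 2 + of_nat k)) \<noteq> 1" if "k \<ge> K" "norm s < R" for k and s :: complex
  proof
    assume "exp (of_real h * (s / 2 + of_nat k)) = 1"
    thus False using K[OF that] by (simp only: norm_one)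
  qed
  define T where "T = (\<lambda>s. \<Sum>k. term_at (k + K) s)"
  have ul: "uniform_limit (ball 0 R) (\<lambda>n s. \<Sum>k<n. term_at (k + K) s) T sequentially"
    unfolding T_def
  proof (rule Weierstrass_m_test)
    show "summable (\<lambda>k. M (k + K))" using sM by (simp add: summable_iff_shift)
  qed (use M in auto)
  have "T holomorphic_on ball 0 R"
  proof (rule holomorphic_uniform_sequence[where f = "\<lambda>n s. \<Sum>k<n. term_at (k + K) s"])
    show "(\<lambda>s. \<Sum>k<n. term_at (k + K) s) holomorphic_on ball 0 R" for n
      by (intro holomorphic_on_sum analytic_imp_holomorphic term_at_analytic neq) auto
    show "\<exists>d>0. cball x d \<subseteq> ball 0 R \<and> uniform_limit (cball x d) (\<lambda>n s. \<Sum>k<n. term_at (k + K) s) T sequentially"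
      if x: "x \<in> ball 0 R" for x
    proof -
      obtain d where "d > 0" "cball x d \<subseteq> ball 0 R" 
        using open_contains_cball_eq[OF open_ball, of 0 R] x by blast
      thus ?thesis using uniform_limit_on_subset[OF ul] by blast
    qed
  qed auto
  hence "T analytic_on ball 0 R" by (simp add: analytic_on_open)
  moreover have "(\<Sum>k. term_at k s) = T s + (\<Sum>k<K. term_at k s)" if "norm s < R" for s
    unfolding T_def
  proof (rule suminf_split_initial_segment)
    have "summable (\<lambda>k. term_at (k + K) s)"
      by (rule summable_comparison_test[where g = "\<lambda>k. M (k + K)"]) (use M that sM in \<open>auto simp: summable_iff_shift\<close>)
    thus "summable (\<lambda>k. term_at k s)" by (subst (asm) summable_iff_shift)
  qed
  ultimately show ?thesis using neq by (rule that[rotated])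
qed

lemma suminf_term_at_meromorphic: "(\<lambda>s. \<Sum>k. term_at k s) meromorphic_on UNIV"
proof -
  have "(\<lambda>s. \<Sum>k. term_at k s) meromorphic_on {s0}" for s0
  proof -
    obtain K T where T: "T analytic_on ball 0 (norm s0 + 1)" 
      "\<And>s. norm s < norm s0 + 1 \<Longrightarrow> (\<Sum>k. term_at k s) = T s + (\<Sum>k<K. term_at k s)"
      using suminf_term_at_split[of "norm s0 + 1"] by metis
    have "T meromorphic_on {s0}"
      by (intro analytic_on_imp_meromorphic_on analytic_on_subset[OF T(1)]) auto
    hence "(\<lambda>s. T s + (\<Sum>k<K. term_at k s)) meromorphic_on {s0}"
      by (intro meromorphic_on_add meromorphic_on_sum term_at_meromorphic)
    moreover have "\<forall>\<^sub>F s in at s0. s \<in> ball 0 (norm s0 + 1)"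
      by (intro eventually_at_in_open') auto
    hence "\<forall>\<^sub>F s in at s0. T s + (\<Sum>k<K. term_at k s) = (\<Sum>k. term_at k s)"
      by eventually_elim (use T(2) in auto)
    ultimately show ?thesis
      by (subst (asm) meromorphic_on_cong) auto
  qed
  thus ?thesis by (subst meromorphic_on_meromorphic_at) auto
qed

text \<open>One neighbourhood serves two purposes: it shows that \<open>regular\<close> is open and
  that the sum is analytic at \<open>s0\<close>.\<close>

lemma suminf_term_at_analytic_open:
  assumes "s0 \<in> regular"
  obtains A where "open A" "s0 \<in> A" "A \<subseteq> regular" "(\<lambda>s. \<Sum>k. term_at k s) holomorphic_on A"
proof -
  define R where "R = norm s0 + 1"
  obtain K T where T: "\<And>k (s :: complex). k \<ge> K \<Longrightarrow> norm s < R \<Longrightarrow> exp (of_real h * (s / 2 + of_nat k)) \<noteq> 1" 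
    "T analytic_on ball 0 R" "\<And>s. norm s < R \<Longrightarrow> (\<Sum>k. term_at k s) = T s + (\<Sum>k<K. term_at k s)"
    using suminf_term_at_split[of R] by metis
  define A where "A = ball 0 R \<inter> (\<Inter>k<K. {s::complex. exp (of_real h * (s / 2 + of_nat k)) \<noteq> 1})"
  have "open A"
    unfolding A_def by (intro open_Int open_INT open_Collect_neq continuous_intros ballI) auto
  moreover have "s0 \<in> A" using assms by (auto simp: A_def R_def regular_def)
  moreover have "A \<subseteq> regular"
  proof
    fix s assume s: "s \<in> A"
    have "exp (of_real h * (s / 2 + of_nat k)) \<noteq> 1" for k
    proof (cases "k < K")
      case True
      thus ?thesis using s by (auto simp: A_def)
    next
      case False
      thus ?thesis using s by (intro T(1)) (auto simp: A_def)
    qed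
    thus "s \<in> regular" by (auto simp: regular_def)
  qed
  moreover have "(\<lambda>s. T s + (\<Sum>k<K. term_at k s)) analytic_on A"
    by (intro analytic_intros analytic_on_subset[OF T(2)] term_at_analytic) (auto simp: A_def)
  hence "(\<lambda>s. T s + (\<Sum>k<K. term_at k s)) holomorphic_on A" by (rule analytic_imp_holomorphic)
  hence "(\<lambda>s. \<Sum>k. term_at k s) holomorphic_on A"
    by (rule holomorphic_transform) (use T(3) in \<open>auto simp: A_def\<close>)
  ultimately show ?thesis by (rule that)
qed

lemma open_regular: "open regular"
  by (subst open_subopen) (meson suminf_term_at_analytic_open)

lemma suminf_term_at_analytic: "(\<lambda>s. \<Sum>k. term_at k s) analytic_on regular"
proof (subst analytic_on_analytic_at, intro ballI)
  fix s0 assume "s0 \<in> regular"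
  thus "(\<lambda>s. \<Sum>k. term_at k s) analytic_on {s0}"
    by (metis suminf_term_at_analytic_open analytic_at)
qed

text \<open>For the identity theorem: the plane without a countable set is connected.\<close>

lemma connected_regular: "connected regular"
proof -
  have "UNIV - regular \<subseteq> (\<lambda>(k, m). 2 * (2 * of_real pi * \<i> * of_int m / of_real h - of_nat k)) ` (UNIV \<times> UNIV)"
  proof
    fix s assume "s \<in> UNIV - regular"
    then obtain k where "exp (of_real h * (s / 2 + of_nat k)) = 1" by (auto simp: regular_def)
    then obtain m :: int where m: "Re (of_real h * (s / 2 + of_nat k)) = 0" "Im (of_real h * (s / 2 + of_nat k)) = of_int (2 * m) * pi"
      by (subst (asm) exp_eq_1) auto
    have "of_real h * (s / 2 + of_nat k) = of_int (2 * m) * of_real pi * \<i>"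
      by (rule complex_eqI) (use m in auto)
    hence "s / 2 + of_nat k = 2 * of_real pi * \<i> * of_int m / of_real h" using h_pos by (simp add: field_simps)
    hence "s = 2 * (2 * of_real pi * \<i> * of_int m / of_real h - of_nat k)" by (simp add: field_simps)
    thus "s \<in> (\<lambda>(k, m). 2 * (2 * of_real pi * \<i> * of_int m / of_real h - of_nat k)) ` (UNIV \<times> UNIV)" 
      by (intro image_eqI[of _ _ "(k, m)"]) auto
  qed
  hence "countable (UNIV - regular)"
    by (rule countable_subset) auto
  hence "connected (UNIV - (UNIV - regular))"
    by (intro connected_open_diff_countable) auto
  thus ?thesis by (simp add: double_diff)
qed

section \<open>Agreement with the series over n in the right half plane\<close>

lemma regular_if_Re_pos: "Re s > 0 \<Longrightarrow> s \<in> regular"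
proof -
  assume s: "Re s > 0"
  have "norm (exp (of_real h * (s / 2 + of_nat k))) \<noteq> 1" for k
    using s h_pos by (simp add: add_eq_0_iff2)
  hence "exp (of_real h * (s / 2 + of_nat k)) \<noteq> 1" for k
    by (metis norm_one)
  thus ?thesis by (simp add: regular_def)
qed

text \<open>Along \<open>k\<close> the double series is a binomial series in exp (-t n), along
  \<open>n\<close> a geometric one. As t n >= h / 2 for n >= 1, the product of a geometric series in
  \<open>n\<close> and a binomial series at exp (-h / 2) dominates it.\<close>

lemma has_sum_suminf_term_at:
  assumes s: "Re s > 0"
  shows "((\<lambda>n. exp (- (of_real (h * (real n - p)) * s / 2)) * (1 - e * of_real (exp (- (h * (real n - p))))) powr (- s))
     has_sum (\<Sum>k. term_at k s)) {1..}"
proof -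
  define t where "t = (\<lambda>n. h * (real n - p))"
  define u where "u = (\<lambda>n k. e ^ k * (pochhammer s k / fact k) * exp (- (of_real (t n) * (s / 2 + of_nat k))))"
  define a where "a = (\<lambda>k. pochhammer (norm s) k / fact k * exp (- h / 2) ^ k)"
  define b where "b = (\<lambda>n. exp (- (t n * Re s / 2)))"
  have t_ge: "t n \<ge> h / 2" if "n \<ge> 1" for n
    unfolding t_def using mult_left_mono[of "1 / 2" "real n - p" h] that p h_pos by auto
  have a_nonneg: "a k \<ge> 0" for k
    unfolding a_def by (intro mult_nonneg_nonneg divide_nonneg_nonneg order.trans[OF norm_ge_zero norm_pochhammer_le[OF order.refl]]) auto
  have bnd: "norm (u n k) \<le> b n * a k" if n: "n \<ge> 1" for n k
  proof -
    have "norm (u n k) = norm (pochhammer s k) / fact k * exp (- (t n * (Re s / 2 + real k)))"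
      by (simp add: u_def norm_mult norm_divide norm_power norm_e)
    also have "\<dots> = exp (- (t n * Re s / 2)) * (norm (pochhammer s k) / fact k * exp (- (t n * real k)))"
      by (simp add: mult_exp_exp algebra_simps)
    also have "\<dots> \<le> exp (- (t n * Re s / 2)) * (pochhammer (norm s) k / fact k * exp (- h / 2 * real k))"
      using mult_right_mono[OF t_ge[OF n], of "real k"]
      by (intro mult_left_mono mult_mono divide_right_mono norm_pochhammer_le)
         (simp_all add: order.trans[OF norm_ge_zero norm_pochhammer_le[OF order.refl]])
    also have "exp (- h / 2 * real k) = exp (- h / 2) ^ k" by (simp add: exp_of_nat_mult[symmetric] mult_ac)
    finally show ?thesis by (simp add: a_def b_def)
  qed
  have sum_a: "a summable_on UNIV"
    using h_pos unfolding a_def by (intro summable_nonneg_imp_summable_on summable_pochhammer_powser) (use a_nonneg in \<open>auto simp: a_def\<close>)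
  have sum_b: "b summable_on {1..}"
  proof -
    have "norm (exp (- (h * Re s / 2))) < 1" using h_pos s by simp
    from has_sum_geometric_from_1[OF this]
    have "(\<lambda>n. exp (h * p * Re s / 2) * exp (- (h * Re s / 2)) ^ n) summable_on {1..}"
      by (intro summable_on_cmult_right) (auto simp: summable_on_def)
    also have "(\<lambda>n. exp (h * p * Re s / 2) * exp (- (h * Re s / 2)) ^ n) = b"
      by (intro ext) (simp add: b_def t_def exp_of_nat_mult[symmetric] mult_exp_exp algebra_simps diff_divide_distrib)
    finally show ?thesis .
  qed
  have summ: "(\<lambda>(n, k). u n k) summable_on {1..} \<times> UNIV"
  proof (rule abs_summable_summable, rule Infinite_Sum.abs_summable_on_comparison_test')
    show "(\<lambda>(n, k). b n * a k) summable_on {1..} \<times> UNIV"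
      by (intro summable_on_mult_Times sum_a sum_b a_nonneg) (simp add: b_def)
  qed (use bnd in auto)
  have rows: "(u n has_sum exp (- (of_real (t n) * s / 2)) * (1 - e * of_real (exp (- t n))) powr (- s)) UNIV" 
    if n: "n \<in> {1..}" for n
  proof -
    define x where "x = e * of_real (exp (- t n))"
    have nx: "norm x < 1"
      using t_ge[of n] n h_pos by (simp add: x_def norm_mult norm_e)
    have eq: "exp (- (of_real (t n) * s / 2)) * (pochhammer s k / fact k * x ^ k) = u n k" for k
    proof -
      have "exp (- (of_real (t n) * (s / 2 + of_nat k))) = exp (- (of_real (t n) * s / 2)) * of_real (exp (- t n)) ^ k"
      proof -
        have "(of_real (exp (- t n)) :: complex) ^ k = exp (of_nat k * of_real (- t n))"
          by (simp only: exp_of_real exp_of_nat_mult)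
        thus ?thesis by (simp add: mult_exp_exp algebra_simps)
      qed
      thus ?thesis by (simp add: u_def x_def power_mult_distrib)
    qed
    have "(u n) sums (exp (- (of_real (t n) * s / 2)) * (1 - x) powr (- s))"
      using sums_mult[OF pochhammer_powser_sums[OF nx, of s], of "exp (- (of_real (t n) * s / 2))"] unfolding eq .
    moreover have "u n summable_on UNIV"
      by (rule summable_on_SigmaD1[OF summ n])
    ultimately show ?thesis
      unfolding x_def by (rule has_sum_if_sums_summable_on)
  qed
  have cols: "((\<lambda>n. u n k) has_sum term_at k s) {1..}" for k
  proof -
    define X where "X = s / 2 + of_nat k"
    define y where "y = exp (of_real h * X)"
    have y: "norm (1 / y) < 1" "y \<noteq> 0" "y \<noteq> 1"
      using s h_pos regular_if_Re_pos[OF s] by (auto simp: y_def X_def norm_divide regular_def add_pos_nonneg)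
    have "((\<lambda>n. e ^ k * (pochhammer s k / fact k) * exp (of_real (p * h) * X) * (1 / y) ^ n) has_sum 
       (e ^ k * (pochhammer s k / fact k) * exp (of_real (p * h) * X) * (1 / y / (1 - 1 / y)))) {1..}"
      by (intro has_sum_cmult_right has_sum_geometric_from_1 y)
    also have "1 / y / (1 - 1 / y) = 1 / (y - 1)" using y by (simp add: divide_simps)
    also have "(\<lambda>n. e ^ k * (pochhammer s k / fact k) * exp (of_real (p * h) * X) * (1 / y) ^ n) = (\<lambda>n. u n k)"
    proof
      fix n
      have "(1 / y) ^ n = exp (- (of_nat n * (of_real h * X)))"
        by (simp add: y_def exp_minus exp_of_nat_mult power_one_over inverse_eq_divide)
      hence "exp (of_real (p * h) * X) * (1 / y) ^ n = exp (- (of_real (t n) * X))"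
        by (simp add: mult_exp_exp t_def algebra_simps)
      thus "e ^ k * (pochhammer s k / fact k) * exp (of_real (p * h) * X) * (1 / y) ^ n = u n k"
        by (simp only: u_def X_def mult.assoc)
    qed
    finally show ?thesis by (simp add: term_at_def X_def y_def)
  qed
  obtain S where S: "((\<lambda>n. exp (- (of_real (t n) * s / 2)) * (1 - e * of_real (exp (- t n))) powr (- s)) has_sum S) {1..}"
    "((\<lambda>k. term_at k s) has_sum S) UNIV"
    using has_sum_interchange[OF summ rows cols] by blast
  have "S = (\<Sum>k. term_at k s)"
    using has_sum_imp_sums[OF S(2)] by (simp add: sums_iff)
  with S(1) show ?thesis by (simp add: t_def)
qed

end

section \<open>The Gamma series\<close>

text \<open>Termwise in Euler's limit: |n powr z| depends only on \<open>Re z\<close>, and each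
  denominator factor satisfies |z + i| >= Re z + i.\<close>

lemma norm_Gamma_le:
  fixes z :: complex
  assumes z: "Re z > 0"
  shows "norm (Gamma z) \<le> Gamma (Re z)"
proof (rule LIMSEQ_le)
  show "(\<lambda>n. norm (Gamma_series z n)) \<longlonglongrightarrow> norm (Gamma z)"
    by (intro tendsto_norm Gamma_series_LIMSEQ)
  show "Gamma_series (Re z) \<longlonglongrightarrow> Gamma (Re z)"
    by (rule Gamma_series_LIMSEQ)
  have "norm (Gamma_series z n) \<le> Gamma_series (Re z) n" for n
  proof -
    have "pochhammer (Re z) (Suc n) \<le> norm (pochhammer z (Suc n))"
      unfolding pochhammer_prod prod_norm[symmetric]
    proof (intro prod_mono conjI)
      fix i
      show "Re z + of_nat i \<le> norm (z + of_nat i)" using complex_Re_le_cmod[of "z + of_nat i"] by simp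
    qed (use z in auto)
    moreover have "pochhammer (Re z) (Suc n) > 0" using z by (intro pochhammer_pos)
    ultimately have "fact n * exp (Re z * ln (real n)) / norm (pochhammer z (Suc n)) \<le> fact n * exp (Re z * ln (real n)) / pochhammer (Re z) (Suc n)"
      by (intro divide_left_mono mult_pos_pos) auto
    thus ?thesis by (simp add: Gamma_series_def norm_mult norm_divide del: pochhammer_Suc)
  qed
  thus "\<exists>N. \<forall>n\<ge>N. norm (Gamma_series z n) \<le> Gamma_series (Re z) n" by blast
qed

text \<open>
  The true decay is exponential, but a factor \<open>1 / \<bar>Im z\<bar>\<close> from each of the two Gamma factors already
  makes the series over \<open>m\<close> converge locally uniformly.
\<close>

lemma norm_Gamma_vertical_le:
  fixes R :: real
  obtains C where "C \<ge> 0" "\<And>z. \<bar>Re z\<bar> \<le> R \<Longrightarrow> \<bar>Im z\<bar> \<ge> 1 \<Longrightarrow> norm (Gamma z) \<le> C / \<bar>Im z\<bar>"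
proof -
  \<comment> \<open>Shifting by \<open>N\<close> moves the strip to real parts in a compact interval
    from 1 on. As N >= 1 and |Im z| >= 1, the product of the \<open>N\<close> shifted factors is at
    least |Im z|.\<close>
  define N where "N = Suc (nat \<lceil>R\<rceil>)"
  have N: "real N \<ge> R + 1" unfolding N_def by linarith
  have "continuous_on {1..real N + R} (Gamma :: real \<Rightarrow> real)"
    by (intro continuous_on_Gamma) (auto dest: nonpos_Ints_nonpos)
  hence "bounded (Gamma ` {1..real N + R} :: real set)"
    by (intro compact_imp_bounded compact_continuous_image) auto
  then obtain C where "\<forall>y\<in>Gamma ` {1..real N + R}. norm y \<le> C"
    unfolding bounded_iff by blast
  hence C: "norm (Gamma x) \<le> C" if "x \<in> {1..real N + R}" for x
    using that by blast
  have "norm (Gamma z) \<le> max C 0 / \<bar>Im z\<bar>" if z: "\<bar>Re z\<bar> \<le> R" "\<bar>Im z\<bar> \<ge> 1" for z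
  proof -
    have z_nonpos: "z \<notin> \<int>\<^sub>\<le>\<^sub>0"
      using z(2) by (auto elim!: nonpos_Ints_cases)
    have mem: "Re z + real N \<in> {1..real N + R}" using z N by auto
    have "norm (Gamma (z + of_nat N)) \<le> Gamma (Re (z + of_nat N))"
      using mem by (intro norm_Gamma_le) auto
    also have "\<dots> \<le> C" using C[OF mem] by simp
    finally have num: "norm (Gamma (z + of_nat N)) \<le> max C 0" by simp
    have "\<bar>Im z\<bar> ^ 1 \<le> \<bar>Im z\<bar> ^ N" using z(2) by (intro power_increasing) (auto simp: N_def)
    also have "\<dots> = (\<Prod>i=0..<N. \<bar>Im z\<bar>)" by simp
    also have "\<dots> \<le> norm (pochhammer z N)"
      unfolding pochhammer_prod prod_norm[symmetric]
    proof (intro prod_mono conjI)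
      fix i
      show "\<bar>Im z\<bar> \<le> norm (z + of_nat i)" using abs_Im_le_cmod[of "z + of_nat i"] by simp
    qed auto
    finally have den: "\<bar>Im z\<bar> \<le> norm (pochhammer z N)" by simp
    have "Gamma z = Gamma (z + of_nat N) / pochhammer z N"
      using pochhammer_Gamma[OF z_nonpos, of N] den z by (auto simp: Gamma_eq_zero_iff z_nonpos divide_simps mult.commute)
    hence "norm (Gamma z) = norm (Gamma (z + of_nat N)) / norm (pochhammer z N)" by (simp add: norm_divide)
    also have "\<dots> \<le> max C 0 / \<bar>Im z\<bar>"
      using num den z(2) by (intro frac_le) auto
    finally show ?thesis .
  qed
  thus ?thesis by (intro that[of "max C 0"]) auto
qed

section \<open>Locally uniform convergence of the series over m\<close>

context sinh_series
begin

abbreviation period :: complex where "period \<equiv> 2 * of_real pi * \<i> / of_real h"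

definition gamma_term :: "int \<Rightarrow> complex \<Rightarrow> complex" where
  "gamma_term m s = (-1) powi m * (Gamma (s / 2 + period * of_int m) * Gamma (s / 2 - period * of_int m))"

lemma exp_lattice_regular: "s \<in> regular \<Longrightarrow> exp_lattice h s"
  using h_pos by unfold_locales (auto simp: regular_def)

lemma regular_node:
  assumes "s \<in> regular"
  shows "s / 2 + period * of_int m \<notin> \<int>\<^sub>\<le>\<^sub>0" "s / 2 - period * of_int m \<notin> \<int>\<^sub>\<le>\<^sub>0"
proof -
  interpret exp_lattice h s by (rule exp_lattice_regular) fact
  show "s / 2 + period * of_int m \<notin> \<int>\<^sub>\<le>\<^sub>0" "s / 2 - period * of_int m \<notin> \<int>\<^sub>\<le>\<^sub>0"
    using node_notin_nonpos_Ints[of m] node_notin_nonpos_Ints[of "-m"]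
    by (simp_all add: node_def exp_lattice.step_def[OF exp_lattice_axioms])
qed

lemma gamma_term_holomorphic: "A \<subseteq> regular \<Longrightarrow> gamma_term m holomorphic_on A"
  unfolding gamma_term_def[abs_def] using regular_node by (intro holomorphic_intros) auto

text \<open>For large |m| both Gamma arguments lie far up or down a fixed vertical strip. For the
  finitely many other \<open>m\<close> the term is continuous on \<open>K\<close>, since
  \<open>K\<close> avoids the poles, and hence bounded.\<close>

lemma norm_gamma_term_le:
  assumes K: "compact K" "K \<subseteq> regular"
  obtains C where "\<And>m s. s \<in> K \<Longrightarrow> norm (gamma_term m s) \<le> C * (1 + of_int \<bar>m\<bar>) powr (-2)"
proof -
  define t where "t = 2 * pi / h"
  have t: "t > 0" using h_pos by (simp add: t_def)
  have period: "period = \<i> * of_real t" by (simp add: t_def)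
  obtain R where R: "\<And>s. s \<in> K \<Longrightarrow> norm s \<le> R" "R > 0"
    using compact_imp_bounded[OF K(1)] by (auto simp: bounded_pos)
  obtain C where C: "C \<ge> 0" "\<And>z. \<bar>Re z\<bar> \<le> R \<Longrightarrow> \<bar>Im z\<bar> \<ge> 1 \<Longrightarrow> norm (Gamma z) \<le> C / \<bar>Im z\<bar>"
    using norm_Gamma_vertical_le by blast
  \<comment> \<open>Outside \<open>F\<close> the imaginary parts, at least t * |m| - R in modulus,
    are at least 1 and at least t * |m| / 2.\<close>
  define F where "F = {m::int. t * of_int \<bar>m\<bar> < 2 * R + 2}"
  have "F \<subseteq> {-\<lceil>(2 * R + 2) / t\<rceil>..\<lceil>(2 * R + 2) / t\<rceil>}"
  proof
    fix m assume "m \<in> F"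
    hence "of_int \<bar>m\<bar> \<le> (2 * R + 2) / t" using t by (simp add: F_def field_simps)
    hence "\<bar>m\<bar> \<le> \<lceil>(2 * R + 2) / t\<rceil>" by linarith
    thus "m \<in> {-\<lceil>(2 * R + 2) / t\<rceil>..\<lceil>(2 * R + 2) / t\<rceil>}" by auto
  qed
  hence fin: "finite F" by (rule finite_subset) auto
  have "\<exists>B. \<forall>s\<in>K. norm (gamma_term m s) \<le> B" for m
  proof -
    have "compact (gamma_term m ` K)"
      by (intro compact_continuous_image K(1) holomorphic_on_imp_continuous_on gamma_term_holomorphic K(2))
    thus ?thesis using compact_imp_bounded[of "gamma_term m ` K"] by (auto simp: bounded_iff)
  qed
  then obtain B where B: "\<And>m s. s \<in> K \<Longrightarrow> norm (gamma_term m s) \<le> B m" by metis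
  define C' where "C' = (4 * C / t)\<^sup>2"
  define D where "D = C' + (\<Sum>m\<in>F. \<bar>B m\<bar> * (1 + of_int \<bar>m\<bar>)\<^sup>2)"
  have S0: "(\<Sum>m\<in>F. \<bar>B m\<bar> * (1 + of_int \<bar>m\<bar>)\<^sup>2) \<ge> 0" by (intro sum_nonneg) auto
  have "norm (gamma_term m s) \<le> D * (1 + of_int \<bar>m\<bar>) powr (-2)" if s: "s \<in> K" for m s
  proof -
    define M where "M = (1 + of_int \<bar>m\<bar> :: real)"
    have M: "M \<ge> 1" by (simp add: M_def)
    have "norm (gamma_term m s) * M\<^sup>2 \<le> D"
    proof (cases "m \<in> F")
      case True
      have "norm (gamma_term m s) * M\<^sup>2 \<le> \<bar>B m\<bar> * M\<^sup>2"
        using B[OF s, of m] by (intro mult_right_mono) auto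
      also have "\<dots> \<le> (\<Sum>m\<in>F. \<bar>B m\<bar> * (1 + of_int \<bar>m\<bar>)\<^sup>2)"
        unfolding M_def using fin True by (intro member_le_sum[where f = "\<lambda>m. \<bar>B m\<bar> * (1 + of_int \<bar>m\<bar>)\<^sup>2"]) auto
      also have "\<dots> \<le> D" by (simp add: D_def C'_def)
      finally show ?thesis .
    next
      case False
      define y where "y = t * \<bar>of_int m\<bar> - R"
      have large: "t * \<bar>of_int m\<bar> \<ge> 2 * R + 2" using False by (simp add: F_def)
      have m1: "\<bar>of_int m\<bar> \<ge> (1::real)" 
      proof (cases "m = 0")
        case True
        thus ?thesis using large R(2) by simp
      qed linarith
      have y: "y \<ge> t * \<bar>of_int m\<bar> / 2" "y \<ge> 1" using large R(2) by (auto simp: y_def)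
      have "t * M \<le> t * (2 * \<bar>of_int m\<bar>)" using t m1 by (intro mult_left_mono) (auto simp: M_def)
      hence yM: "y \<ge> t * M / 4" using y(1) by linarith
      have sR: "\<bar>Re s\<bar> \<le> R" "\<bar>Im s\<bar> \<le> R" 
        using R(1)[OF s] abs_Re_le_cmod[of s] abs_Im_le_cmod[of s] by auto
      have tm: "\<bar>t * of_int m\<bar> = t * \<bar>of_int m\<bar>" using t by (simp add: abs_mult)
      have G: "norm (Gamma z) \<le> C / (t * M / 4)" if "Re z = Re s / 2" "\<bar>Im z\<bar> \<ge> y" for z
      proof -
        have "norm (Gamma z) \<le> C / \<bar>Im z\<bar>"
          using that y sR R(2) by (intro C(2)) auto
        also have "\<dots> \<le> C / (t * M / 4)"
          using C(1) that y(2) yM t M by (intro divide_left_mono mult_pos_pos) auto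
        finally show ?thesis .
      qed
      have "norm (gamma_term m s) = norm (Gamma (s / 2 + period * of_int m)) * norm (Gamma (s / 2 - period * of_int m))"
        by (simp add: gamma_term_def norm_mult norm_power_int)
      also have "\<dots> \<le> (C / (t * M / 4)) * (C / (t * M / 4))"
      proof (intro mult_mono G)
        show "y \<le> \<bar>Im (s / 2 + period * of_int m)\<bar>" "y \<le> \<bar>Im (s / 2 - period * of_int m)\<bar>"
          unfolding period using sR tm by (simp_all add: y_def)
        show "Re (s / 2 + period * of_int m) = Re s / 2" "Re (s / 2 - period * of_int m) = Re s / 2"
          unfolding period by simp_all
      qed (use C(1) t M in auto)
      also have "\<dots> * M\<^sup>2 = C'"
        using t M by (simp add: C'_def power2_eq_square field_simps)
      finally have "norm (gamma_term m s) * M\<^sup>2 \<le> C'" using M by (simp add: mult_right_mono)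
      thus ?thesis using S0 by (simp add: D_def)
    qed
    thus ?thesis using M unfolding M_def[symmetric]
      by (simp add: powr_minus powr_numeral field_simps)
  qed
  thus ?thesis by (rule that)
qed

text \<open>The uniform limit is taken along the finite sets of integers, the filter that defines
  the unordered sum, so no enumeration of \<open>m\<close> intervenes.\<close>

lemma gamma_term_sum_holomorphic:
  assumes s0: "s0 \<in> regular"
  shows "(\<lambda>m. gamma_term m s0) summable_on UNIV" and "(\<lambda>s. \<Sum>\<^sub>\<infinity>m. gamma_term m s) field_differentiable at s0"
proof -
  obtain r where r: "r > 0" "cball s0 r \<subseteq> regular"
    using open_contains_cball[of regular] open_regular s0 by blast
  obtain C where C: "\<And>m s. s \<in> cball s0 r \<Longrightarrow> norm (gamma_term m s) \<le> C * (1 + of_int \<bar>m\<bar>) powr (-2)"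
    using norm_gamma_term_le[OF compact_cball r(2)] by blast
  have "(\<lambda>n. (1 + real n) powr (-2)) summable_on UNIV"
    using summable_on_Suc_powr[of "-2"] by simp
  hence "(\<lambda>m::int. (1 + of_int \<bar>m\<bar> :: real) powr (-2)) summable_on UNIV"
    by (intro summable_on_int) simp_all
  hence M: "(\<lambda>m::int. C * (1 + of_int \<bar>m\<bar>) powr (-2)) summable_on UNIV"
    by (rule summable_on_cmult_right)
  show "(\<lambda>m. gamma_term m s0) summable_on UNIV"
    by (rule abs_summable_summable, rule Infinite_Sum.abs_summable_on_comparison_test'[OF M]) (use C r(1) in auto)
  have lim: "uniform_limit (cball s0 r) (\<lambda>X s. \<Sum>m\<in>X. gamma_term m s) (\<lambda>s. \<Sum>\<^sub>\<infinity>m. gamma_term m s) (finite_subsets_at_top UNIV)"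
    by (rule Weierstrass_m_test_general[OF _ M]) (use C in auto)
  have hol: "(\<lambda>s. \<Sum>m\<in>X. gamma_term m s) holomorphic_on cball s0 r" for X
    using r(2) by (intro holomorphic_on_sum gamma_term_holomorphic)
  have cont: "\<forall>\<^sub>F X in finite_subsets_at_top UNIV. continuous_on (cball s0 r) (\<lambda>s. \<Sum>m\<in>X. gamma_term m s) \<and>
      (\<lambda>s. \<Sum>m\<in>X. gamma_term m s) holomorphic_on ball s0 r"
    by (intro always_eventually allI conjI holomorphic_on_imp_continuous_on hol holomorphic_on_subset[OF hol ball_subset_cball])
  have "(\<lambda>s. \<Sum>\<^sub>\<infinity>m. gamma_term m s) holomorphic_on ball s0 r"
    by (rule holomorphic_uniform_limit[OF cont lim finite_subsets_at_top_neq_bot])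
  thus "(\<lambda>s. \<Sum>\<^sub>\<infinity>m. gamma_term m s) field_differentiable at s0"
    using r(1) by (simp add: holomorphic_on_imp_differentiable_at)
qed

end

text \<open>The interchange proves the identity on the strip \<open>U\<close>; both sides are
  holomorphic on the connected open set \<open>regular\<close> containing it. The entire function
  \<open>rGamma\<close> also covers the negative odd integers, which are regular although Gamma has
  poles there.\<close>

lemma odd_functional_equation:
  assumes h: "h > 0" and s: "s \<in> sinh_series.regular h"
  shows "(\<Sum>k. sinh_series.term_at h (1/2) (-1) k s) = rGamma s / (2 * of_real h) * (\<Sum>\<^sub>\<infinity>m. sinh_series.gamma_term h m s)"
proof -
  interpret sinh_series h "1/2" "-1" using h by unfold_locales auto
  define U where "U = {s. -1 < Re s \<and> Re s < 0}"
  have U_open: "open U"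
    unfolding U_def by (intro open_Collect_conj open_Collect_less continuous_intros)
  have U_regular: "U \<subseteq> regular"
  proof
    fix s assume s: "s \<in> U"
    have "norm (exp (of_real h * (s / 2 + of_nat k))) \<noteq> 1" for k
    proof -
      have "Re s / 2 + real k \<noteq> 0"
      proof
        assume "Re s / 2 + real k = 0"
        hence "2 * real k < 1" "0 < real k" using s by (auto simp: U_def)
        hence "real k \<ge> 1" by simp
        thus False using \<open>2 * real k < 1\<close> by linarith
      qed
      thus ?thesis using h_pos by simp
    qed
    hence "exp (of_real h * (s / 2 + of_nat k)) \<noteq> 1" for k
      by (metis norm_one)
    thus "s \<in> regular" by (simp add: regular_def)
  qed
  show ?thesis
  proof (rule analytic_continuation_open[where f = "\<lambda>s. \<Sum>k. term_at k s" and
      g = "\<lambda>s. rGamma s / (2 * of_real h) * (\<Sum>\<^sub>\<infinity>m. gamma_term m s)", OF U_open open_regular _ connected_regular U_regular])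
    have "-1/2 \<in> U" by (simp add: U_def)
    thus "U \<noteq> {}" by blast
    show "(\<lambda>s. \<Sum>k. term_at k s) holomorphic_on regular"
      by (intro analytic_imp_holomorphic suminf_term_at_analytic)
    have "(\<lambda>s. \<Sum>\<^sub>\<infinity>m. gamma_term m s) holomorphic_on regular"
      unfolding holomorphic_on_def
      by (intro ballI field_differentiable_at_within[OF gamma_term_sum_holomorphic(2)])
    thus "(\<lambda>s. rGamma s / (2 * of_real h) * (\<Sum>\<^sub>\<infinity>m. gamma_term m s)) holomorphic_on regular"
      using h_pos by (intro holomorphic_intros) auto
    fix s assume sU: "s \<in> U"
    interpret E: exp_lattice h s using U_regular sU by (intro exp_lattice_regular) auto
    obtain S where S: "((\<lambda>m. (-1) powi m * (Gamma (E.node m) * Gamma (E.node (- m)) * rGamma s)) has_sum 2 * of_real h * S) UNIV"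
      "((\<lambda>k. (-1) ^ k * (pochhammer s k / fact k) * exp (of_real h * (s / 2 + of_nat k) / 2) / 
        (exp (of_real h * (s / 2 + of_nat k)) - 1)) has_sum S) UNIV"
      using E.odd_double_sum sU by (auto simp: U_def)
    have "(\<lambda>k. (-1) ^ k * (pochhammer s k / fact k) * exp (of_real h * (s / 2 + of_nat k) / 2) / 
        (exp (of_real h * (s / 2 + of_nat k)) - 1)) = (\<lambda>k. term_at k s)"
      by (simp add: term_at_def)
    hence 1: "(\<Sum>k. term_at k s) = S" using has_sum_imp_sums[OF S(2)] by (simp add: sums_iff)
    have "(\<lambda>m. (-1) powi m * (Gamma (E.node m) * Gamma (E.node (- m)) * rGamma s)) = (\<lambda>m. rGamma s * gamma_term m s)"
      by (auto simp: gamma_term_def E.node_def E.step_def mult_ac)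
    hence "2 * of_real h * S = (\<Sum>\<^sub>\<infinity>m. rGamma s * gamma_term m s)"
      using S(1) by (simp add: infsumI)
    also have "\<dots> = rGamma s * (\<Sum>\<^sub>\<infinity>m. gamma_term m s)"
      by (rule infsum_cmult_right')
    finally show "(\<Sum>k. term_at k s) = rGamma s / (2 * of_real h) * (\<Sum>\<^sub>\<infinity>m. gamma_term m s)"
      using 1 h_pos by (simp add: field_simps)
  qed (rule s)
qed

text \<open>The interchange is already valid on the whole half plane, so nothing has to be
  continued. Where a denominator Gamma has a pole, the quotient is 0 by convention, in agreement
  with \<open>rGamma\<close>.\<close>

lemma even_functional_equation:
  fixes s :: complex
  assumes h: "h > 0" and s: "s \<in> sinh_series.regular h" "Re s < 0"
  defines "d \<equiv> 2 * of_real pi * \<i> / of_real h"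
  defines "f \<equiv> (\<lambda>m::int. Gamma (s / 2 - d * of_int m) / Gamma (1 - s / 2 - d * of_int m))"
  shows "f summable_on UNIV"
    and "(\<Sum>k. sinh_series.term_at h 0 1 k s) = Gamma (1 - s) / of_real h * (\<Sum>\<^sub>\<infinity>m. f m)"
proof -
  interpret sinh_series h 0 1 using h by unfold_locales auto
  interpret E: exp_lattice h s using s by (intro exp_lattice_regular) auto
  obtain S where S: "((\<lambda>m. Gamma (1 - s) * (Gamma (E.node m) * rGamma (E.node m + 1 - s))) has_sum of_real h * S) UNIV"
    "((\<lambda>k. pochhammer s k / fact k / (exp (of_real h * (s / 2 + of_nat k)) - 1)) has_sum S) UNIV"
    using E.even_double_sum s by auto
  have "(\<lambda>k. pochhammer s k / fact k / (exp (of_real h * (s / 2 + of_nat k)) - 1)) = (\<lambda>k. term_at k s)"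
    by (simp add: term_at_def)
  hence 1: "(\<Sum>k. term_at k s) = S" using has_sum_imp_sums[OF S(2)] by (simp add: sums_iff)
  have "1 - s \<notin> \<int>\<^sub>\<le>\<^sub>0"
  proof
    assume "1 - s \<in> \<int>\<^sub>\<le>\<^sub>0"
    then obtain n where "1 - s = of_int n" "n \<le> 0" by (auto elim: nonpos_Ints_cases)
    hence "Re (1 - s) \<le> 0" by simp
    thus False using s by simp
  qed
  hence G: "Gamma (1 - s) \<noteq> 0" by (simp add: Gamma_eq_zero_iff)
  have "E.node m + 1 - s = 1 - s / 2 - d * of_int m" "E.node m = s / 2 - d * of_int m" for m
    by (simp_all add: E.node_def E.step_def d_def)
  hence "(\<lambda>m. Gamma (1 - s) * (Gamma (E.node m) * rGamma (E.node m + 1 - s))) = (\<lambda>m. Gamma (1 - s) * f m)"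
    unfolding f_def rGamma_inverse_Gamma by (simp only: divide_inverse)
  hence S1: "(f has_sum (of_real h * S / Gamma (1 - s))) UNIV"
    using S(1) G by (simp add: has_sum_cmult_right_iff)
  thus "f summable_on UNIV" by (auto simp: summable_on_def)
  show "(\<Sum>k. term_at k s) = Gamma (1 - s) / of_real h * (\<Sum>\<^sub>\<infinity>m. f m)"
    using infsumI[OF S1] 1 G h by simp
qed

section \<open>The generalised Fibonacci numbers\<close>

text \<open>Norm -1 makes -1 / \<epsilon> the conjugate of \<epsilon>. Conjugation negates the
  square root in the denominator, so the trace becomes a difference of conjugate powers.\<close>

lemma gen_fib_eq:
  assumes D: "D > 1" "squarefree (D :: int)" and mem: "\<epsilon> \<in> quad_field D"
    and norm: "field_norm (quad_field D) \<epsilon> = -1"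
  shows "gen_fib D \<epsilon> n = (\<epsilon> ^ n - (-1 / \<epsilon>) ^ n) / sqrt (of_int (quad_disc D))"
proof -
  define r where "r = sqrt (of_int D)"
  have r2: "r * r = of_rat (of_int D)" and r: "r > 0" using D by (simp_all add: r_def)
  obtain a b where ab: "\<epsilon> = of_rat a + of_rat b * r"
    using mem by (auto simp: quad_field_def r_def)
  define \<epsilon>' where "\<epsilon>' = of_rat a - of_rat b * r"
  have "\<epsilon> * \<epsilon>' = (of_rat a)\<^sup>2 - (r * r) * (of_rat b)\<^sup>2"
    unfolding ab \<epsilon>'_def by (simp add: algebra_simps power2_eq_square)
  also have "\<dots> = -1"
    using norm field_norm_quad_field[OF D, of a b, folded r_def] unfolding r2 ab by simp
  finally have prod: "\<epsilon> * \<epsilon>' = -1" .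
  hence "\<epsilon> \<noteq> 0" by auto
  with prod have \<epsilon>': "\<epsilon>' = -1 / \<epsilon>" by (simp add: field_simps)
  have "\<exists>x y. \<epsilon> ^ n = of_rat x + of_rat y * r \<and> \<epsilon>' ^ n = of_rat x - of_rat y * r"
  proof (induction n)
    case 0
    show ?case by (intro exI[of _ 1] exI[of _ 0]) simp
  next
    case (Suc n)
    then obtain x y where xy: "\<epsilon> ^ n = of_rat x + of_rat y * r" "\<epsilon>' ^ n = of_rat x - of_rat y * r" by blast
    have "\<epsilon> ^ Suc n = of_rat a * of_rat x + of_rat b * of_rat y * (r * r) + (of_rat a * of_rat y + of_rat b * of_rat x) * r"
      unfolding power_Suc xy by (simp add: ab algebra_simps)
    moreover have "\<epsilon>' ^ Suc n = of_rat a * of_rat x + of_rat b * of_rat y * (r * r) - (of_rat a * of_rat y + of_rat b * of_rat x) * r"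
      unfolding power_Suc xy by (simp add: \<epsilon>'_def algebra_simps)
    ultimately show ?case
      unfolding r2 of_rat_mult[symmetric] of_rat_add[symmetric] by blast
  qed
  then obtain x y where xy: "\<epsilon> ^ n = of_rat x + of_rat y * r" "\<epsilon>' ^ n = of_rat x - of_rat y * r" by blast
  define c :: rat where "c = (if D mod 4 = 1 then 1 else 2)"
  have c: "c \<noteq> 0" by (simp add: c_def)
  have q: "sqrt (of_int (quad_disc D)) = of_rat c * r"
    by (simp add: quad_disc_def c_def r_def real_sqrt_mult)
  have D0: "(of_int D :: rat) \<noteq> 0" using D by simp
  \<comment> \<open>Rationalising the denominator, 1 / r = r / D, brings the argument of the trace
    into coordinates.\<close>
  have rr: "of_rat x / (of_rat c * r) = of_rat (x / (c * of_int D)) * r"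
    using r c D0 r2 by (simp add: of_rat_divide of_rat_mult divide_simps del: of_rat_of_int_eq)
  have "\<epsilon> ^ n / sqrt (of_int (quad_disc D)) = of_rat (y / c) + of_rat (x / (c * of_int D)) * r"
    unfolding q xy add_divide_distrib rr using r c by (simp add: of_rat_divide)
  hence "gen_fib D \<epsilon> n = 2 * of_rat (y / c)"
    unfolding gen_fib_def using field_trace_quad_field[OF D, of "y / c" "x / (c * of_int D)"] by (simp add: r_def)
  also have "\<dots> = (\<epsilon> ^ n - \<epsilon>' ^ n) / sqrt (of_int (quad_disc D))"
    unfolding q xy using r c by (simp add: of_rat_divide)
  finally show ?thesis by (simp only: \<epsilon>')
qed

text \<open>All bases are positive reals, so the complex powers split through the real logarithm
  without a question of branches.\<close>

lemma inverse_powr_exp_form: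
  fixes q t e :: real and s :: complex
  assumes q: "q > 0" and t: "1 - e * exp (- t) > 0"
  shows "1 / of_real (exp (t / 2) * (1 - e * exp (- t)) / sqrt q) powr s =
    of_real q powr (s / 2) * (exp (- (of_real t * s / 2)) * (1 - of_real e * of_real (exp (- t))) powr (- s))"
proof -
  define u where "u = 1 - e * exp (- t)"
  define F where "F = exp (t / 2) * u / sqrt q"
  have u: "u > 0" using t by (simp add: u_def)
  have F: "F > 0" using u q by (simp add: F_def)
  have "ln F = t / 2 + ln u - ln q / 2"
    using u q by (simp add: F_def ln_div ln_mult ln_sqrt)
  hence ln_F: "complex_of_real (ln F) = of_real t / 2 + of_real (ln u) - of_real (ln q) / 2"
    by (simp only: of_real_add of_real_diff of_real_divide of_real_numeral)
  have "- (s * of_real (ln F)) = s / 2 * of_real (ln q) + (- (of_real t * s / 2) + - s * of_real (ln u))"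
    unfolding ln_F by (simp add: algebra_simps)
  hence "exp (- (s * of_real (ln F))) = exp (s / 2 * of_real (ln q)) * (exp (- (of_real t * s / 2)) * exp (- s * of_real (ln u)))"
    by (simp only: exp_add)
  moreover have "1 / of_real F powr s = exp (- (s * of_real (ln F)))"
    using F by (simp add: powr_def Ln_of_real exp_minus inverse_eq_divide)
  moreover have "of_real q powr (s / 2) = exp (s / 2 * of_real (ln q))"
    using q by (simp add: powr_def Ln_of_real)
  moreover have "1 - of_real e * of_real (exp (- t)) = (of_real u :: complex)"
    by (simp add: u_def)
  moreover have "of_real u powr (- s) = exp (- s * of_real (ln u))"
    using u by (simp add: powr_def Ln_of_real)
  ultimately show ?thesis unfolding F_def u_def[symmetric] by (simp only:)
qed

section \<open>Assembly of the two zeta functions\<close>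

theorem theorem1:
  fixes D :: int and \<epsilon> :: real
  assumes "D > 1" and "squarefree D"
    and "fundamental_unit D \<epsilon>"
    and "field_norm (quad_field D) \<epsilon> = -1"
  shows
    "(\<forall>s::complex. Re s > 0 \<longrightarrow>
        (\<lambda>n. 1 / complex_of_real (gen_fib D \<epsilon> (2 * n - 1)) powr s) summable_on {1..} \<and>
        (\<lambda>n. 1 / complex_of_real (gen_fib D \<epsilon> (2 * n)) powr s) summable_on {1..}) \<and>
     (\<exists>Z_odd Z_even :: complex \<Rightarrow> complex.
        Z_odd nicely_meromorphic_on UNIV \<and>
        Z_even nicely_meromorphic_on UNIV \<and>
        (\<forall>s::complex. Re s > 0 \<longrightarrow>
           Z_odd s = (\<Sum>\<^sub>\<infinity>n\<in>{1..}. 1 / complex_of_real (gen_fib D \<epsilon> (2 * n - 1)) powr s) \<and>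
           Z_even s = (\<Sum>\<^sub>\<infinity>n\<in>{1..}. 1 / complex_of_real (gen_fib D \<epsilon> (2 * n)) powr s)) \<and>
        (\<forall>s::complex. (\<forall>m::int. s / 2 + of_real pi * \<i> * of_int m / (2 * of_real (ln \<epsilon>)) \<notin> \<int>\<^sub>\<le>\<^sub>0 \<and>
                       s / 2 - of_real pi * \<i> * of_int m / (2 * of_real (ln \<epsilon>)) \<notin> \<int>\<^sub>\<le>\<^sub>0) \<longrightarrow>
           (\<lambda>m::int. (-1) powi m * Gamma (s / 2 + of_real pi * \<i> * of_int m / (2 * of_real (ln \<epsilon>)))
                                 * Gamma (s / 2 - of_real pi * \<i> * of_int m / (2 * of_real (ln \<epsilon>))))
             summable_on UNIV \<and>
           Z_odd s = of_int (quad_disc D) powr (s / 2) / (8 * Gamma s * of_real (ln \<epsilon>)) *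
             (\<Sum>\<^sub>\<infinity>m::int. (-1) powi m * Gamma (s / 2 + of_real pi * \<i> * of_int m / (2 * of_real (ln \<epsilon>)))
                                     * Gamma (s / 2 - of_real pi * \<i> * of_int m / (2 * of_real (ln \<epsilon>))))) \<and>
        (\<forall>s::complex. Re s < 0 \<and> (\<forall>m::int. s / 2 - of_real pi * \<i> * of_int m / (2 * of_real (ln \<epsilon>)) \<notin> \<int>\<^sub>\<le>\<^sub>0) \<longrightarrow>
           (\<lambda>m::int. Gamma (s / 2 - of_real pi * \<i> * of_int m / (2 * of_real (ln \<epsilon>)))
                     / Gamma (1 - s / 2 - of_real pi * \<i> * of_int m / (2 * of_real (ln \<epsilon>))))
             summable_on UNIV \<and>
           Z_even s = of_int (quad_disc D) powr (s / 2) * Gamma (1 - s) / (4 * of_real (ln \<epsilon>)) *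
             (\<Sum>\<^sub>\<infinity>m::int. Gamma (s / 2 - of_real pi * \<i> * of_int m / (2 * of_real (ln \<epsilon>)))
                         / Gamma (1 - s / 2 - of_real pi * \<i> * of_int m / (2 * of_real (ln \<epsilon>))))))"
proof -
  define L where "L = ln \<epsilon>"
  \<comment> \<open>The \<open>j\<close>-th number is governed by t = 2 L j; indices of equal parity
    differ by 2, so \<open>t\<close> advances by 4 L.\<close>
  define h where "h = 4 * L"
  define q :: real where "q = of_int (quad_disc D)"
  have \<epsilon>: "\<epsilon> > 1" "\<epsilon> \<in> quad_field D"
    using assms(3) by (auto simp: fundamental_unit_def Let_def unit_group_def ring_of_integers_def)
  have L: "L > 0" using \<epsilon> by (simp add: L_def)
  have h: "h > 0" using L by (simp add: h_def)
  have q: "q > 0" using assms(1) by (auto simp: q_def quad_disc_def)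
  interpret odd: sinh_series h "1/2" "-1" using h by unfold_locales auto
  interpret even: sinh_series h 0 1 using h by unfold_locales auto
  define Zo where "Zo = (\<lambda>s. of_real q powr (s / 2) * (\<Sum>k. odd.term_at k s))"
  define Ze where "Ze = (\<lambda>s. of_real q powr (s / 2) * (\<Sum>k. even.term_at k s))"

  have power: "\<epsilon> ^ j = exp (real j * L)" for j
    using \<epsilon>(1) by (simp add: L_def exp_of_nat_mult)
  have fib: "gen_fib D \<epsilon> j = exp (2 * L * real j / 2) * (1 - (-1) ^ j * exp (- (2 * L * real j))) / sqrt q" for j
  proof -
    have "(-1 / \<epsilon>) ^ j = (-1) ^ j * exp (- (real j * L))"
    proof -
      have "-1 / \<epsilon> = (-1) * (1 / \<epsilon>)" by simp
      thus ?thesis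
        by (simp only: power_mult_distrib power_one_over power exp_minus inverse_eq_divide)
    qed
    moreover have "exp (- (real j * L)) = exp (real j * L) * exp (- (2 * L * real j))"
      by (simp add: mult_exp_exp)
    ultimately show ?thesis
      using gen_fib_eq[OF assms(1,2) \<epsilon>(2) assms(4), of j]
      by (simp add: power q_def algebra_simps)
  qed
  have pos: "1 - e * exp (- t) > 0" if "t > 0" "e = 1 \<or> e = -1" for e t :: real
    using that exp_gt_zero[of "- t"] by (auto simp del: exp_gt_zero)
  have has_sum_odd: "((\<lambda>n. 1 / complex_of_real (gen_fib D \<epsilon> (2 * n - 1)) powr s) has_sum Zo s) {1..}" if s: "Re s > 0" for s
  proof -
    have "((\<lambda>n. of_real q powr (s / 2) * (exp (- (of_real (h * (real n - 1 / 2)) * s / 2)) * 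
        (1 - (- 1) * of_real (exp (- (h * (real n - 1 / 2))))) powr (- s))) has_sum Zo s) {1..}"
      unfolding Zo_def by (intro has_sum_cmult_right odd.has_sum_suminf_term_at s)
    also have "?this \<longleftrightarrow> ?thesis"
    proof (intro has_sum_cong)
      fix n :: nat assume n: "n \<in> {1..}"
      define t where "t = h * (real n - 1 / 2)"
      have t: "t > 0" using h n by (simp add: t_def)
      \<comment> \<open>This is the origin of p = 1 / 2: 2 L (2 n - 1) = h (n - 1 / 2). The
        subtraction on naturals is genuine since n >= 1.\<close>
      have "2 * L * real (2 * n - 1) = t"
        using n by (simp add: t_def h_def of_nat_diff algebra_simps)
      moreover have "odd (2 * n - 1)" using n by simp
      ultimately have "gen_fib D \<epsilon> (2 * n - 1) = exp (t / 2) * (1 - (- 1) * exp (- t)) / sqrt q"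
        unfolding fib by simp
      thus "of_real q powr (s / 2) * (exp (- (of_real (h * (real n - 1 / 2)) * s / 2)) * 
        (1 - (- 1) * of_real (exp (- (h * (real n - 1 / 2))))) powr (- s)) = 
        1 / complex_of_real (gen_fib D \<epsilon> (2 * n - 1)) powr s"
        using inverse_powr_exp_form[OF q pos[OF t, of "-1"], of s] by (simp add: t_def)
    qed
    finally show ?thesis .
  qed
  have has_sum_even: "((\<lambda>n. 1 / complex_of_real (gen_fib D \<epsilon> (2 * n)) powr s) has_sum Ze s) {1..}" if s: "Re s > 0" for s
  proof -
    have "((\<lambda>n. of_real q powr (s / 2) * (exp (- (of_real (h * (real n - 0)) * s / 2)) * 
        (1 - 1 * of_real (exp (- (h * (real n - 0))))) powr (- s))) has_sum Ze s) {1..}"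
      unfolding Ze_def by (intro has_sum_cmult_right even.has_sum_suminf_term_at s)
    also have "?this \<longleftrightarrow> ?thesis"
    proof (intro has_sum_cong)
      fix n :: nat assume n: "n \<in> {1..}"
      define t where "t = h * (real n - 0)"
      have t: "t > 0" using h n by (simp add: t_def)
      have "2 * L * real (2 * n) = t" by (simp add: t_def h_def)
      hence "gen_fib D \<epsilon> (2 * n) = exp (t / 2) * (1 - 1 * exp (- t)) / sqrt q"
        unfolding fib by simp
      thus "of_real q powr (s / 2) * (exp (- (of_real (h * (real n - 0)) * s / 2)) * 
        (1 - 1 * of_real (exp (- (h * (real n - 0))))) powr (- s)) = 
        1 / complex_of_real (gen_fib D \<epsilon> (2 * n)) powr s"
        using inverse_powr_exp_form[OF q pos[OF t, of 1], of s] by (simp add: t_def)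
    qed
    finally show ?thesis .
  qed

  have powr_analytic: "(\<lambda>s. of_real q powr (s / 2) :: complex) analytic_on A" for A
    using q by (simp add: powr_def) (intro analytic_intros, auto)
  have mero: "Zo meromorphic_on UNIV" "Ze meromorphic_on UNIV"
    unfolding Zo_def Ze_def
    by (intro meromorphic_on_mult analytic_on_imp_meromorphic_on[OF powr_analytic] 
          odd.suminf_term_at_meromorphic even.suminf_term_at_meromorphic)+
  have "Zo analytic_on odd.regular" "Ze analytic_on odd.regular"
    unfolding Zo_def Ze_def
    by (intro analytic_on_mult powr_analytic odd.suminf_term_at_analytic even.suminf_term_at_analytic)+
  \<comment> \<open>\<open>Zo\<close> and \<open>Ze\<close> have arbitrary values at exceptional
    points. \<open>remove_sings\<close> repairs them for nice meromorphy and changes nothing on the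
    regular set.\<close>
  hence rem: "remove_sings Zo s = Zo s" "remove_sings Ze s = Ze s" if "s \<in> odd.regular" for s
    using that by (auto intro!: remove_sings_at_analytic intro: analytic_on_subset)

  have step: "odd.period * of_int m = of_real pi * \<i> * of_int m / (2 * of_real (ln \<epsilon>))" for m
    by (simp add: h_def L_def)
  \<comment> \<open>By periodicity of \<open>exp\<close> a failing \<open>k\<close> comes with an
    integer \<open>m\<close> for which s / 2 - 2 pi i m / h = -k, an excluded Gamma
    argument.\<close>
  have regularI: "s \<in> odd.regular" if "\<And>m::int. s / 2 - of_real pi * \<i> * of_int m / (2 * of_real (ln \<epsilon>)) \<notin> \<int>\<^sub>\<le>\<^sub>0" for s
    unfolding odd.regular_def
  proof (intro CollectI allI notI)
    fix k assume "exp (of_real h * (s / 2 + of_nat k)) = 1"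
    then obtain m :: int where m: "Re (of_real h * (s / 2 + of_nat k)) = 0" "Im (of_real h * (s / 2 + of_nat k)) = of_int (2 * m) * pi"
      by (subst (asm) exp_eq_1) auto
    have "of_real h * (s / 2 + of_nat k) = of_int (2 * m) * of_real pi * \<i>"
      by (rule complex_eqI) (use m in auto)
    hence "s / 2 - odd.period * of_int m = - of_nat k" using h by (simp add: field_simps)
    thus False using that[of m] unfolding step by simp
  qed

  have q': "complex_of_real q = of_int (quad_disc D)" and h': "complex_of_real h = 4 * of_real (ln \<epsilon>)"
    by (simp_all add: q_def h_def L_def)
  \<comment> \<open>The case g = 0 is real: at negative odd integers Gamma is 0 by convention, and
    both sides vanish.\<close>
  have odd_const: "x * (inverse g / (2 * (4 * l)) * y) = x / (8 * g * l) * y" for x y g l :: complex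
    by (cases "g = 0 \<or> l = 0") (auto simp: field_simps)

  show ?thesis
  proof (rule conjI[OF _ exI[of _ "remove_sings Zo", OF exI[of _ "remove_sings Ze"]]]; intro conjI allI impI)
    fix s :: complex assume s: "Re s > 0"
    show "(\<lambda>n. 1 / complex_of_real (gen_fib D \<epsilon> (2 * n - 1)) powr s) summable_on {1..}"
      "(\<lambda>n. 1 / complex_of_real (gen_fib D \<epsilon> (2 * n)) powr s) summable_on {1..}"
      using has_sum_odd[OF s] has_sum_even[OF s] by (auto simp: summable_on_def)
    show "remove_sings Zo s = (\<Sum>\<^sub>\<infinity>n\<in>{1..}. 1 / complex_of_real (gen_fib D \<epsilon> (2 * n - 1)) powr s)"
      "remove_sings Ze s = (\<Sum>\<^sub>\<infinity>n\<in>{1..}. 1 / complex_of_real (gen_fib D \<epsilon> (2 * n)) powr s)"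
      using infsumI[OF has_sum_odd[OF s]] infsumI[OF has_sum_even[OF s]] rem[OF odd.regular_if_Re_pos[OF s]] by simp_all
  next
    show "remove_sings Zo nicely_meromorphic_on UNIV" "remove_sings Ze nicely_meromorphic_on UNIV"
      by (intro remove_sings_nicely_meromorphic mero)+
  next
    fix s :: complex
    assume "\<forall>m::int. s / 2 + of_real pi * \<i> * of_int m / (2 * of_real (ln \<epsilon>)) \<notin> \<int>\<^sub>\<le>\<^sub>0 \<and>
                       s / 2 - of_real pi * \<i> * of_int m / (2 * of_real (ln \<epsilon>)) \<notin> \<int>\<^sub>\<le>\<^sub>0"
    hence s: "s \<in> odd.regular" by (intro regularI) auto
    have summand: "(-1) powi m * Gamma (s / 2 + of_real pi * \<i> * of_int m / (2 * of_real (ln \<epsilon>)))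
       * Gamma (s / 2 - of_real pi * \<i> * of_int m / (2 * of_real (ln \<epsilon>))) = odd.gamma_term m s" for m
      unfolding odd.gamma_term_def step by (simp only: mult.assoc)
    show "(\<lambda>m::int. (-1) powi m * Gamma (s / 2 + of_real pi * \<i> * of_int m / (2 * of_real (ln \<epsilon>)))
       * Gamma (s / 2 - of_real pi * \<i> * of_int m / (2 * of_real (ln \<epsilon>)))) summable_on UNIV"
      unfolding summand by (rule odd.gamma_term_sum_holomorphic(1)[OF s])
    show "remove_sings Zo s = of_int (quad_disc D) powr (s / 2) / (8 * Gamma s * of_real (ln \<epsilon>)) *
             (\<Sum>\<^sub>\<infinity>m::int. (-1) powi m * Gamma (s / 2 + of_real pi * \<i> * of_int m / (2 * of_real (ln \<epsilon>)))
                                     * Gamma (s / 2 - of_real pi * \<i> * of_int m / (2 * of_real (ln \<epsilon>))))"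
      unfolding rem(1)[OF s] summand
      unfolding Zo_def odd_functional_equation[OF h s] rGamma_inverse_Gamma q' h' by (rule odd_const)
  next
    fix s :: complex
    assume "Re s < 0 \<and> (\<forall>m::int. s / 2 - of_real pi * \<i> * of_int m / (2 * of_real (ln \<epsilon>)) \<notin> \<int>\<^sub>\<le>\<^sub>0)"
    hence s: "s \<in> odd.regular" "Re s < 0" by (auto intro: regularI)
    note fe = even_functional_equation[OF h s, unfolded step]
    show "(\<lambda>m::int. Gamma (s / 2 - of_real pi * \<i> * of_int m / (2 * of_real (ln \<epsilon>)))
                     / Gamma (1 - s / 2 - of_real pi * \<i> * of_int m / (2 * of_real (ln \<epsilon>)))) summable_on UNIV"
      by (rule fe(1))
    show "remove_sings Ze s = of_int (quad_disc D) powr (s / 2) * Gamma (1 - s) / (4 * of_real (ln \<epsilon>)) *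
             (\<Sum>\<^sub>\<infinity>m::int. Gamma (s / 2 - of_real pi * \<i> * of_int m / (2 * of_real (ln \<epsilon>)))
                         / Gamma (1 - s / 2 - of_real pi * \<i> * of_int m / (2 * of_real (ln \<epsilon>))))"
      unfolding rem(2)[OF s(1)]
      unfolding Ze_def fe(2) q' h' by (simp only: times_divide_eq_left times_divide_eq_right mult.assoc)
  qed
qed

end
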